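(* For all positive integers $s,r,t,m$ and prime powers $q$ satisfying $s\le t\le m<q$, there is an explicit collection of $M=\Omega\!\left(\frac{q^r}{rt}\right)$ linear subspaces $H_1,\dots,H_M\subseteq\mathbb{F}_q^m$, each of co-dimension $rt$, which forms a strong $(s,A)$ subspace design, where $A\le\frac{\left(m-1-\frac{s-1}{2}\right)s}{r(t-s+1)}$, and even $A\le\frac{(m-s)s}{r(t-s+1)}$ if $m<\mathrm{char}\,\mathbb{F}_q$.
   Context: A collection of subspaces $H_1,\dots,H_M\subseteq\mathbb{F}_q^{m}$ is a strong $(s,A)$ subspace design if for every $\mathbb{F}_q$-linear subspace $W\subseteq\mathbb{F}_q^{m}$ of dimension $s$, $\sum_{i=1}^M\dim_{\mathbb{F}_q}(H_i\cap W)\le A$. The $\Omega$ hides an absolute positive constant.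
   Formalization: The co-dimension is stated as min(rt, m) instead of rt, since for rt > m (e.g. s=t=m=1, r=2, q=2) no subspace of co-dimension rt exists although M must be positive; for rt ≤ m it is exactly rt. *)

theory Defs
  imports "HOL-Analysis.Analysis" "HOL-Computational_Algebra.Computational_Algebra"
begin

text \<open>
  The field with \<open>q\<close> elements is an arbitrary type \<open>'a::{finite,field}\<close> with \<open>q = CARD('a)\<close>,
  and its \<open>m\<close>-dimensional coordinate space is \<open>'a^'m\<close> with \<open>m = CARD('m)\<close>. Subspaces and
  dimensions are \<open>vec.subspace\<close> and \<open>vec.dim\<close>, taken over the field \<open>'a\<close> itself.
\<close>

definition codim :: "('a::field ^ 'm) set \<Rightarrow> nat" where
  "codim H = CARD('m) - vec.dim H"

definition strong_subspace_design ::
    "nat \<Rightarrow> real \<Rightarrow> ('a::field ^ 'm) set list \<Rightarrow> bool" where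
  "strong_subspace_design s A Hs \<longleftrightarrow>
     (\<forall>H\<in>set Hs. vec.subspace H) \<and>
     (\<forall>W. vec.subspace W \<and> vec.dim W = s \<longrightarrow>
        real (\<Sum>i<length Hs. vec.dim (Hs ! i \<inter> W)) \<le> A)"

text \<open>
  The absolute constant hidden in \<open>\<Omega>\<close>. The field and the dimension are types, so an
  existential quantifier inside a theorem could not range outside them and its witness might
  depend on \<open>q\<close> and \<open>m\<close>. A fixed numeral keeps the constant absolute; the value is not optimised.
\<close>

definition omega_const :: real where
  "omega_const = 1 / 100"

text \<open>
  To say that the collection is explicit, we give it as the output of an algorithm whose only
  inputs are \<open>r\<close>, \<open>t\<close>, a list \<open>fs\<close> of the field elements and a list \<open>cs\<close> of the coordinates:
  only finite searches in fixed orders are used, and no choice operator. A vector is read as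
  the coefficient sequence of a polynomial of degree less than \<open>m\<close>.
\<close>

definition vec_poly :: "'m list \<Rightarrow> 'a::field ^ 'm \<Rightarrow> 'a poly" where
  "vec_poly cs v = Poly (map (\<lambda>c. v $ c) cs)"

definition irreducible_polys :: "'a::field list \<Rightarrow> nat \<Rightarrow> 'a poly list" where
  "irreducible_polys fs r =
     filter irreducible (map (\<lambda>as. Poly (as @ [1])) (List.n_lists r fs))"

definition primitive_elem :: "'a::field list \<Rightarrow> 'a" where
  "primitive_elem fs = hd (filter (\<lambda>g. range (\<lambda>k::nat. g ^ k) = - {0}) fs)"

text \<open>The polynomials \<open>p(X), p(g X), \<dots>, p(g\<^sup>t\<^sup>-\<^sup>1 X)\<close>.\<close>

definition twists :: "'a::field \<Rightarrow> nat \<Rightarrow> 'a poly \<Rightarrow> 'a poly list" where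
  "twists g t p = map (\<lambda>j. p \<circ>\<^sub>p [:0, g ^ j:]) [0..<t]"

text \<open>
  Greedy selection of polynomials whose twists are pairwise coprime, both for each polynomial
  by itself and across the selected polynomials. If \<open>p\<close> is irreducible with root \<open>\<alpha>\<close>, its twists
  have the roots \<open>g\<^sup>-\<^sup>j \<alpha>\<close> and their conjugates, so these root sets are required to be disjoint.
\<close>

definition select_twist_coprime :: "'a::field \<Rightarrow> nat \<Rightarrow> 'a poly list \<Rightarrow> 'a poly list" where
  "select_twist_coprime g t ps =
     fold (\<lambda>p sel. if sorted_wrt coprime (concat (map (twists g t) (p # sel)))
                    then p # sel else sel) ps []"

definition folded_subspace :: "'m list \<Rightarrow> 'a::field \<Rightarrow> nat \<Rightarrow> 'a poly \<Rightarrow> ('a ^ 'm) set" where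
  "folded_subspace cs g t p = {v. \<forall>f\<in>set (twists g t p). f dvd vec_poly cs v}"

definition mult_subspace :: "'m list \<Rightarrow> nat \<Rightarrow> 'a::field poly \<Rightarrow> ('a ^ 'm) set" where
  "mult_subspace cs t p = {v. p ^ t dvd vec_poly cs v}"

text \<open>
  Vanishing to order \<open>t\<close> at one point of degree \<open>r\<close> is used when the characteristic exceeds \<open>m\<close>
  (ordinary Wronskians), and vanishing at \<open>t\<close> points in geometric progression otherwise
  (folded Wronskians).
\<close>

definition explicit_collection ::
    "'a::{finite,field} list \<Rightarrow> 'm::finite list \<Rightarrow> nat \<Rightarrow> nat \<Rightarrow> ('a ^ 'm) set list" where
  "explicit_collection fs cs r t =
     (if CARD('m) < CHAR('a)
      then map (mult_subspace cs t) (irreducible_polys fs r)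
      else let g = primitive_elem fs
           in map (folded_subspace cs g t) (select_twist_coprime g t (irreducible_polys fs r)))"

end

theory Submission
  imports Defs "Jordan_Normal_Form.Determinant" "HOL-Algebra.Multiplicative_Group"
    "HOL-Number_Theory.Residues"
begin

text \<open>
  For a subspace \<open>W\<close> of dimension \<open>s\<close> take the Wronskian of a basis of \<open>W\<close>, where
  \<open>W\<close> is regarded as a space of polynomials: the ordinary one if the characteristic exceeds
  \<open>m\<close>, otherwise the folded one, with \<open>f(g\<^sup>j X)\<close> in place of the \<open>j\<close>-th derivative.
  On a basis with distinct degrees its leading coefficient is a Vandermonde determinant, so the
  Wronskian is nonzero and its degree is at most the numerator of the bound. On a basis adapted to
  \<open>H\<^sub>p \<inter> W\<close> it is visibly divisible by \<open>p ^ ((t - s + 1) * dim (H\<^sub>p \<inter> W))\<close>,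
  respectively by the \<open>dim (H\<^sub>p \<inter> W)\<close>-th power of each of \<open>t - s + 1\<close> twists of
  \<open>p\<close>. A change of basis only contributes a nonzero constant, and the divisors for
  different \<open>p\<close> are coprime, so comparing degrees bounds the sum of the dimensions.

  For the size of the collection, a monic irreducible \<open>p\<close> whose own twists are not coprime
  is \<open>X\<close> or a polynomial in \<open>X\<^sup>e\<close> with \<open>e > 1\<close>, which is rare; any other
  one is blocked in the greedy selection only by being, up to a constant, one of fewer than
  \<open>2 t\<close> twists of a selected polynomial.
\<close>


subsection \<open>Counting monic irreducible polynomials\<close>

definition monic_polys :: "nat \<Rightarrow> 'a::field poly set" where
  "monic_polys n = {f. degree f = n \<and> lead_coeff f = 1}"

definition monic_irreducibles :: "nat \<Rightarrow> 'a::field poly set" where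
  "monic_irreducibles n = {p \<in> monic_polys n. irreducible p}"

lemma monic_polys_nonzero: "f \<in> monic_polys n \<Longrightarrow> f \<noteq> 0"
  by (auto simp: monic_polys_def)

text \<open>\<open>Poly\<close> strips trailing zeros; the final 1 prevents this, so the list can be
  read back and distinct lists give distinct monic polynomials.\<close>

lemma coeffs_Poly_snoc_1: "coeffs (Poly (as @ [1::'a::field])) = as @ [1]"
  by simp

lemma inj_Poly_snoc_1: "inj (\<lambda>as. Poly (as @ [1::'a::field]))"
  by (metis (lifting) append_same_eq coeffs_Poly_snoc_1 injI)

lemma monic_polys_eq_image:
  "monic_polys n = (\<lambda>as. Poly (as @ [1::'a::field])) ` {as. length as = n}"
proof (rule Set.set_eqI, rule iffI)
  fix f :: "'a poly" assume f: "f \<in> monic_polys n"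
  then have "coeffs f \<noteq> []" "last (coeffs f) = 1" "length (coeffs f) = Suc n"
    by (auto simp: monic_polys_def last_coeffs_eq_coeff_degree length_coeffs_degree monic_polys_nonzero[OF f])
  then have "coeffs f = butlast (coeffs f) @ [1]" "length (butlast (coeffs f)) = n"
    by (metis append_butlast_last_id, simp)
  then show "f \<in> (\<lambda>as. Poly (as @ [1])) ` {as. length as = n}"
    by (metis (mono_tags, lifting) Poly_coeffs imageI mem_Collect_eq)
next
  fix f :: "'a poly" assume "f \<in> (\<lambda>as. Poly (as @ [1])) ` {as. length as = n}"
  then obtain as where as: "f = Poly (as @ [1])" "length as = n" by auto
  have c: "coeffs f = as @ [1]" using as coeffs_Poly_snoc_1 by blast
  then have "f \<noteq> 0" by auto
  then have "lead_coeff f = 1" using c last_coeffs_eq_coeff_degree[of f] by simp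
  then show "f \<in> monic_polys n"
    using c as(2) by (simp add: monic_polys_def degree_eq_length_coeffs)
qed

lemma finite_monic_polys: "finite (monic_polys n :: 'a::{finite,field} poly set)"
  using finite_lists_length_eq[of "UNIV :: 'a set" n] by (simp add: monic_polys_eq_image)

lemma card_monic_polys: "card (monic_polys n :: 'a::{finite,field} poly set) = CARD('a) ^ n"
  using card_lists_length_eq[of "UNIV :: 'a set" n]
  by (simp add: monic_polys_eq_image card_image[OF inj_on_subset[OF inj_Poly_snoc_1]])

lemma monic_polys_mult:
  assumes "f \<in> monic_polys n" "g \<in> monic_polys k" shows "f * g \<in> monic_polys (n + k)"
  using assms monic_polys_nonzero[OF assms(1)] monic_polys_nonzero[OF assms(2)]
  by (auto simp: monic_polys_def degree_mult_eq coeff_mult_degree_sum)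

lemma monic_polys_power: "f \<in> monic_polys n \<Longrightarrow> f ^ k \<in> monic_polys (k * n)"
proof (induction k)
  case 0 then show ?case by (simp add: monic_polys_def)
next
  case (Suc k) then show ?case using monic_polys_mult[of f n "f^k" "k*n"] by simp
qed

lemma monic_polys_cofactor:
  assumes "h \<in> monic_polys e" "h * g \<in> monic_polys n" shows "e \<le> n \<and> g \<in> monic_polys (n - e)"
proof -
  have "g \<noteq> 0" "h \<noteq> 0" using monic_polys_nonzero[OF assms(2)] by auto
  then have "degree (h * g) = degree h + degree g" "lead_coeff (h * g) = lead_coeff h * lead_coeff g"
    by (simp add: degree_mult_eq, metis lead_coeff_mult)
  then show ?thesis using assms by (auto simp: monic_polys_def)
qed

text \<open>Multiplication by \<open>h\<close> maps the monic polynomials of degree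
  \<open>n - e\<close> bijectively onto these multiples.\<close>

lemma card_monic_multiples:
  assumes h: "(h :: 'a::{finite,field} poly) \<in> monic_polys e" and e: "e \<le> n"
  shows "card {f \<in> monic_polys n. h dvd f} = CARD('a) ^ (n - e)"
proof -
  have "{f \<in> monic_polys n. h dvd f} = (\<lambda>g. h * g) ` monic_polys (n - e)"
    using monic_polys_cofactor[OF h] monic_polys_mult[OF h, of _ "n - e"] e by (auto elim!: dvdE)
  moreover have "inj_on (\<lambda>g. h * g) (monic_polys (n - e))"
    using monic_polys_nonzero[OF h] by (auto intro: inj_onI)
  ultimately show ?thesis by (simp add: card_image card_monic_polys)
qed

text \<open>A divisor of \<open>f\<close> of least positive degree is irreducible, since a factor of
  smaller degree also divides \<open>f\<close> and is therefore constant. Scaling makes it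
  monic.\<close>

lemma obtain_monic_irreducible_dvd:
  assumes "degree (f :: 'a::field poly) > 0"
  obtains d p where "p \<in> monic_irreducibles d" "p dvd f"
proof -
  define P where "P = (\<lambda>d. d > 0 \<and> (\<exists>p. degree p = d \<and> p dvd f))"
  have "P (degree f)" using assms by (auto simp: P_def)
  then obtain d where d: "P d" and dmin: "\<And>e. P e \<Longrightarrow> d \<le> e"
    by (metis LeastI Least_le)
  then obtain p where p: "degree p = d" "p dvd f" and "d > 0" by (auto simp: P_def)
  then have p0: "p \<noteq> 0" by auto
  let ?p = "Polynomial.smult (inverse (lead_coeff p)) p"
  have dvd: "?p dvd f" using p(2) p0 by (intro smult_dvd) auto
  have lc: "lead_coeff p \<noteq> 0" using p0 by (rule leading_coeff_neq_0)
  then have m: "?p \<in> monic_polys d" using p(1) by (simp add: monic_polys_def)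
  have f0: "f \<noteq> 0" using assms by auto
  have "irreducible ?p"
  proof (rule irreducibleI)
    show "?p \<noteq> 0" using p0 by simp
    show "\<not> ?p dvd 1" 
    proof
      assume "?p dvd 1"
      then have "degree ?p = 0" using is_unit_iff_degree[OF \<open>?p \<noteq> 0\<close>] by blast
      then show False using m \<open>d > 0\<close> by (simp add: monic_polys_def)
    qed
    fix a b assume ab: "?p = a * b"
    then have ab0: "a \<noteq> 0" "b \<noteq> 0" using p0 by (metis \<open>?p \<noteq> 0\<close> mult_zero_left mult_zero_right)+
    have deg: "degree a + degree b = d"
      using degree_mult_eq[OF ab0] m unfolding ab[symmetric] by (simp add: monic_polys_def)
    have "a dvd f" using ab dvd by (metis dvd_mult_left)
    then have "degree a = 0 \<or> degree b = 0" 
      using dmin[of "degree a"] deg unfolding P_def by (metis add_diff_cancel_left' diff_is_0_eq gr0I)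
    then show "a dvd 1 \<or> b dvd 1" using ab0 by (auto simp: is_unit_iff_degree)
  qed
  then show thesis using that m dvd by (auto simp: monic_irreducibles_def)
qed

lemma monic_irreducibles_degree:
  assumes "p \<in> monic_irreducibles d" shows "degree p = d" "d > 0" "p \<noteq> 0" "prime_elem p"
proof -
  have i: "irreducible p" and m: "p \<in> monic_polys d" using assms by (auto simp: monic_irreducibles_def)
  show "degree p = d" using m by (simp add: monic_polys_def)
  show "p \<noteq> 0" using m monic_polys_nonzero by blast
  then show "d > 0" using i \<open>degree p = d\<close> by (metis gr_zeroI irreducible_not_unit is_unit_iff_degree)
  show "prime_elem p" using i by (rule field_poly_irreducible_imp_prime)
qed

text \<open>The cofactor is a unit, hence a constant, and comparing leading coefficients shows that
  it is 1.\<close>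

lemma monic_irreducibles_dvd_imp_eq:
  assumes "p \<in> monic_irreducibles d" "q \<in> monic_irreducibles e" "p dvd q" shows "p = q"
proof -
  obtain c where c: "q = p * c" using assms(3) by (auto elim: dvdE)
  have "c dvd 1"
    using assms c monic_irreducibles_degree(4)[OF assms(1)]
    by (metis (no_types, lifting) irreducibleD mem_Collect_eq monic_irreducibles_def prime_elem_not_unit)
  moreover have "lead_coeff q = lead_coeff p * lead_coeff c" using c lead_coeff_mult by blast
  ultimately show ?thesis
    using assms c by (auto simp: monic_irreducibles_def monic_polys_def elim!: is_unit_polyE)
qed

section \<open>Prime power divisors and the count of irreducibles by degree\<close>

definition prime_power_divisors :: "'a::field poly \<Rightarrow> ('a poly \<times> nat) set" where
  "prime_power_divisors f = {(p, k). p \<in> monic_irreducibles (degree p) \<and> k > 0 \<and> p ^ k dvd f}"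

text \<open>Unlike \<open>prime_power_divisors f\<close>, this index set does not depend on
  \<open>f\<close>, so sums over \<open>f\<close> and over prime powers can be interchanged.\<close>

definition prime_powers_upto :: "nat \<Rightarrow> ('a::field poly \<times> nat) set" where
  "prime_powers_upto n = {(p, k). p \<in> monic_irreducibles (degree p) \<and> k > 0 \<and> k * degree p \<le> n}"

lemma finite_prime_powers_upto: "finite (prime_powers_upto n :: ('a::{finite,field} poly \<times> nat) set)"
proof (rule finite_subset)
  show "prime_powers_upto n \<subseteq> (\<Union>d\<le>n. monic_polys d :: 'a poly set) \<times> {..n}"
  proof
    fix x :: "'a poly \<times> nat" assume "x \<in> prime_powers_upto n"
    then obtain p k where x: "x = (p, k)" and p: "p \<in> monic_irreducibles (degree p)"
      and k: "0 < k" "k * degree p \<le> n"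
      by (auto simp: prime_powers_upto_def)
    have d: "degree p > 0" using monic_irreducibles_degree[OF p] by simp
    have "degree p \<le> k * degree p" "k \<le> k * degree p" using k d by simp_all
    then have "degree p \<le> n" "k \<le> n" using k(2) by linarith+
    then show "x \<in> (\<Union>d\<le>n. monic_polys d) \<times> {..n}"
      using p x by (auto simp: monic_irreducibles_def)
  qed
qed (simp add: finite_monic_polys)

lemma prime_power_divisors_subset:
  assumes "f \<in> monic_polys n"
  shows "prime_power_divisors f = {(p, k) \<in> prime_powers_upto n. p ^ k dvd f}"
proof -
  have "k * degree p \<le> n" if "p \<in> monic_irreducibles (degree p)" "p ^ k dvd f" for p k
  proof -
    have "p \<in> monic_polys (degree p)" using that by (simp add: monic_irreducibles_def)
    then have "p ^ k \<in> monic_polys (k * degree p)" by (rule monic_polys_power)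
    then show ?thesis using that(2) assms monic_polys_cofactor by (metis dvdE)
  qed
  then show ?thesis by (auto simp: prime_power_divisors_def prime_powers_upto_def)
qed

text \<open>Each \<open>p\<close> occurs once for every exponent up to its multiplicity in
  \<open>f\<close>, so the sum adds up the degrees of all irreducible factors. The induction splits
  off one factor at a time.\<close>

lemma sum_degree_prime_power_divisors:
  assumes "(f :: 'a::{finite,field} poly) \<in> monic_polys n"
  shows "(\<Sum>(p, k)\<in>prime_power_divisors f. degree p) = n"
  using assms
proof (induction n arbitrary: f rule: less_induct)
  case (less n)
  show ?case
  proof (cases "n = 0")
    case True
    then have "prime_powers_upto n = ({} :: ('a poly \<times> nat) set)"
      using monic_irreducibles_degree(2) by (fastforce simp: prime_powers_upto_def)
    then show ?thesis using prime_power_divisors_subset[OF less.prems] True by simp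
  next
    case False
    then have "degree f > 0" using less.prems by (simp add: monic_polys_def)
    then obtain d p where p: "p \<in> monic_irreducibles d" "p dvd f"
      by (rule obtain_monic_irreducible_dvd)
    then obtain g where g: "f = p * g" by (auto elim: dvdE)
    have "d > 0" and pd: "degree p = d" and p0: "p \<noteq> 0" and pp: "prime_elem p"
      using monic_irreducibles_degree[OF p(1)] by auto
    have gm: "d \<le> n" "g \<in> monic_polys (n - d)"
      using monic_polys_cofactor[of p d g n] p(1) less.prems g by (auto simp: monic_irreducibles_def)
    have IH: "(\<Sum>(p, k)\<in>prime_power_divisors g. degree p) = n - d"
      using less.IH[of "n - d" g] gm \<open>d > 0\<close> False by simp
    have finK: "finite {k. p ^ k dvd g}"
    proof (rule finite_subset)
      show "{k. p ^ k dvd g} \<subseteq> {..degree g}"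
      proof clarsimp
        fix k assume "p ^ k dvd g"
        then have "degree (p ^ k) \<le> degree g"
          using gm(2) monic_polys_nonzero by (intro dvd_imp_degree_le) auto
        then have "k * d \<le> degree g" using p0 pd by (simp add: degree_power_eq)
        moreover have "k \<le> k * d" using \<open>d > 0\<close> by simp
        ultimately show "k \<le> degree g" by linarith
      qed
    qed simp
    \<comment> \<open>The multiplicity of \<open>p\<close> in \<open>g\<close>; passing from
      \<open>g\<close> to \<open>f = p * g\<close> adds exactly the pair
      \<open>(p, Suc j)\<close>.\<close>
    define j where "j = Max {k. p ^ k dvd g}"
    have j1: "p ^ j dvd g" using Max_in[OF finK] unfolding j_def by (metis (mono_tags, lifting) empty_iff mem_Collect_eq one_dvd power_0)
    have j2: "k \<le> j" if "p ^ k dvd g" for k using Max_ge[OF finK] that unfolding j_def by simp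
    have eq: "prime_power_divisors f = insert (p, Suc j) (prime_power_divisors g)"
    proof (rule Set.set_eqI, clarify)
      fix u k
      show "(u, k) \<in> prime_power_divisors f \<longleftrightarrow> (u, k) \<in> insert (p, Suc j) (prime_power_divisors g)"
      proof (cases "u = p")
        case True
        have "p ^ k dvd f \<longleftrightarrow> p ^ (k - 1) dvd g" if "k > 0"
          using that g p0 by (cases k) auto
        moreover have "p ^ (k - 1) dvd g \<longleftrightarrow> k - 1 \<le> j"
          using j1 j2 by (meson dvd_trans le_imp_power_dvd)
        moreover have "p ^ k dvd g \<longleftrightarrow> k \<le> j"
          using j1 j2 by (meson dvd_trans le_imp_power_dvd)
        ultimately show ?thesis using True p pd by (auto simp: prime_power_divisors_def)
      next
        case False
        have "u ^ k dvd f \<longleftrightarrow> u ^ k dvd g" if u: "u \<in> monic_irreducibles (degree u)"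
        proof
          assume "u ^ k dvd f"
          \<comment> \<open>The prime \<open>u\<close> does not divide the factor \<open>p\<close>,
            so the whole power \<open>u ^ k\<close> has to come from \<open>g\<close>.\<close>
          have "\<not> u dvd p" using False monic_irreducibles_dvd_imp_eq[OF u p(1)] by auto
          then show "u ^ k dvd g" using \<open>u ^ k dvd f\<close> monic_irreducibles_degree(4)[OF u] g
            by (metis mult.commute prime_elem_dvd_multD prime_power_dvd_multD power_0 one_dvd neq0_conv)
        qed (simp add: g)
        then show ?thesis using False by (auto simp: prime_power_divisors_def)
      qed
    qed
    have "(p, Suc j) \<notin> prime_power_divisors g" using j2[of "Suc j"] by (auto simp: prime_power_divisors_def)
    moreover have "finite (prime_power_divisors g)"
      using prime_power_divisors_subset[OF gm(2)] 
      by (auto intro: finite_subset[OF _ finite_prime_powers_upto[of "n - d"]])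
    ultimately show ?thesis using IH gm(1) pd by (simp add: eq)
  qed
qed

text \<open>
  Double counting: every monic \<open>f\<close> of degree \<open>n\<close> satisfies
  \<open>n = (\<Sum>(p, k) | p\<^sup>k dvd f. degree p)\<close> (von Mangoldt), and \<open>p\<^sup>k\<close> has
  \<open>q ^ (n - k * degree p)\<close> monic multiples of degree \<open>n\<close>. Comparing \<open>n\<close> with
  \<open>n - 1\<close> isolates the prime powers of degree exactly \<open>n\<close>, without using field extensions.
\<close>
lemma sum_degree_prime_powers_upto:
  "(\<Sum>(p, k)\<in>(prime_powers_upto n :: ('a::{finite,field} poly \<times> nat) set).
      degree p * CARD('a) ^ (n - k * degree p)) = n * CARD('a) ^ n"
proof -
  let ?P = "prime_powers_upto n :: ('a poly \<times> nat) set" and ?M = "monic_polys n :: 'a poly set"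
  have "n * CARD('a) ^ n = (\<Sum>f\<in>?M. n)" by (simp add: card_monic_polys)
  also have "\<dots> = (\<Sum>f\<in>?M. \<Sum>x\<in>?P. if fst x ^ snd x dvd f then degree (fst x) else 0)"
  proof (rule sum.cong)
    fix f assume f: "f \<in> ?M"
    have "(\<Sum>x\<in>?P. if fst x ^ snd x dvd f then degree (fst x) else 0)
        = (\<Sum>x\<in>{x \<in> ?P. fst x ^ snd x dvd f}. degree (fst x))"
      by (rule sum.inter_filter[symmetric]) (rule finite_prime_powers_upto)
    also have "{x \<in> ?P. fst x ^ snd x dvd f} = prime_power_divisors f"
      by (auto simp: prime_power_divisors_subset[OF f])
    also have "(\<Sum>x\<in>prime_power_divisors f. degree (fst x)) = n"
      using sum_degree_prime_power_divisors[OF f] by (simp add: case_prod_unfold)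
    finally show "n = (\<Sum>x\<in>?P. if fst x ^ snd x dvd f then degree (fst x) else 0)" by simp
  qed simp
  also have "\<dots> = (\<Sum>x\<in>?P. \<Sum>f\<in>?M. if fst x ^ snd x dvd f then degree (fst x) else 0)"
    by (rule sum.swap)
  also have "\<dots> = (\<Sum>x\<in>?P. degree (fst x) * CARD('a) ^ (n - snd x * degree (fst x)))"
  proof (rule sum.cong)
    fix x assume "x \<in> ?P"
    then obtain p k where x: "x = (p, k)" and p: "p \<in> monic_irreducibles (degree p)"
      and k: "k * degree p \<le> n"
      by (auto simp: prime_powers_upto_def)
    have pk: "p ^ k \<in> monic_polys (k * degree p)"
      using p by (intro monic_polys_power) (simp add: monic_irreducibles_def)
    have "(\<Sum>f\<in>?M. if p ^ k dvd f then degree p else 0) = (\<Sum>f\<in>{f \<in> ?M. p ^ k dvd f}. degree p)"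
      by (rule sum.inter_filter[symmetric]) (rule finite_monic_polys)
    then show "(\<Sum>f\<in>?M. if fst x ^ snd x dvd f then degree (fst x) else 0)
        = degree (fst x) * CARD('a) ^ (n - snd x * degree (fst x))"
      using card_monic_multiples[OF pk k] unfolding x fst_conv snd_conv by simp
  qed simp
  finally show ?thesis by (simp add: case_prod_unfold)
qed

definition prime_powers :: "nat \<Rightarrow> ('a::field poly \<times> nat) set" where
  "prime_powers n = {(p, k). p \<in> monic_irreducibles (degree p) \<and> k > 0 \<and> k * degree p = n}"

lemma finite_prime_powers: "finite (prime_powers n :: ('a::{finite,field} poly \<times> nat) set)"
  by (rule finite_subset[OF _ finite_prime_powers_upto[of n]])
    (auto simp: prime_powers_def prime_powers_upto_def)

text \<open>A prime power of degree below \<open>n\<close> has \<open>q\<close> times as many monic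
  multiples in degree \<open>n\<close> as in degree \<open>n - 1\<close>. Subtracting
  \<open>q\<close> times the identity for \<open>n - 1\<close> from the one for \<open>n\<close>
  thus leaves \<open>n * q ^ n - (n - 1) * q ^ n = q ^ n\<close>. This is Gauss's formula for the
  number of irreducible polynomials.\<close>

lemma sum_degree_prime_powers:
  assumes "n > 0"
  shows "(\<Sum>x\<in>(prime_powers n :: ('a::{finite,field} poly \<times> nat) set). degree (fst x)) = CARD('a) ^ n"
proof -
  obtain l where n: "n = Suc l" using assms by (cases n) auto
  let ?q = "CARD('a)"
  let ?S = "\<lambda>n. \<Sum>x\<in>(prime_powers_upto n :: ('a poly \<times> nat) set). degree (fst x) * ?q ^ (n - snd x * degree (fst x))"
  have S: "?S n = n * ?q ^ n" for n
    using sum_degree_prime_powers_upto[of n, where 'a='a] by (simp add: case_prod_unfold)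
  have split: "prime_powers_upto n = prime_powers_upto l \<union> (prime_powers n :: ('a poly \<times> nat) set)"
    and disj: "prime_powers_upto l \<inter> (prime_powers n :: ('a poly \<times> nat) set) = {}"
    by (auto simp: prime_powers_def prime_powers_upto_def n)
  have "?S n = (\<Sum>x\<in>(prime_powers_upto l :: ('a poly \<times> nat) set). degree (fst x) * ?q ^ (n - snd x * degree (fst x)))
      + (\<Sum>x\<in>(prime_powers n :: ('a poly \<times> nat) set). degree (fst x) * ?q ^ (n - snd x * degree (fst x)))"
    unfolding split by (rule sum.union_disjoint) (simp_all add: finite_prime_powers_upto finite_prime_powers disj)
  also have "(\<Sum>x\<in>(prime_powers_upto l :: ('a poly \<times> nat) set). degree (fst x) * ?q ^ (n - snd x * degree (fst x)))
      = ?q * ?S l"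
    unfolding sum_distrib_left by (rule sum.cong) (auto simp: prime_powers_upto_def n Suc_diff_le)
  also have "(\<Sum>x\<in>(prime_powers n :: ('a poly \<times> nat) set). degree (fst x) * ?q ^ (n - snd x * degree (fst x)))
      = (\<Sum>x\<in>(prime_powers n :: ('a poly \<times> nat) set). degree (fst x))"
    by (rule sum.cong) (auto simp: prime_powers_def)
  finally show ?thesis unfolding S by (simp add: n)
qed

lemma finite_monic_irreducibles: "finite (monic_irreducibles n :: 'a::{finite,field} poly set)"
  by (rule finite_subset[OF _ finite_monic_polys[of n]]) (auto simp: monic_irreducibles_def)

text \<open>Keep only the pairs with exponent 1 in Gauss's formula.\<close>

lemma card_monic_irreducibles_upper:
  assumes "n > 0"
  shows "n * card (monic_irreducibles n :: 'a::{finite,field} poly set) \<le> CARD('a) ^ n"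
proof -
  have "n * card (monic_irreducibles n :: 'a poly set)
      = (\<Sum>x\<in>(monic_irreducibles n :: 'a poly set) \<times> {1::nat}. degree (fst x))"
    using monic_irreducibles_degree(1)
    by (subst sum.cong[OF refl, of _ _ "\<lambda>_. n"]) (force simp: card_cartesian_product)+
  also have "\<dots> \<le> (\<Sum>x\<in>(prime_powers n :: ('a poly \<times> nat) set). degree (fst x))"
    using monic_irreducibles_degree(1)
    by (intro sum_mono2 finite_prime_powers) (force simp: prime_powers_def)+
  finally show ?thesis using sum_degree_prime_powers[OF assms, where 'a='a] by simp
qed

text \<open>In Gauss's formula, a pair with exponent at least 2 has
  \<open>degree p \<le> r div 2\<close>, and \<open>p\<close> determines the exponent. The upper
  bound, applied in each of these degrees, controls their total.\<close>

lemma card_monic_irreducibles_lower: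
  assumes "r > 0"
  shows "CARD('a) ^ r \<le> r * card (monic_irreducibles r :: 'a::{finite,field} poly set)
           + (\<Sum>d=1..r div 2. CARD('a) ^ d)"
proof -
  let ?A = "(\<lambda>p. (p, 1::nat)) ` (monic_irreducibles r :: 'a poly set)"
  let ?B = "(\<lambda>p. (p, r div degree p)) ` (\<Union>d\<in>{1..r div 2}. monic_irreducibles d :: 'a poly set)"
  have fin: "finite ?A" "finite ?B" by (auto intro: finite_monic_irreducibles)
  have sub: "prime_powers r \<subseteq> ?A \<union> ?B"
  proof
    fix x :: "'a poly \<times> nat" assume "x \<in> prime_powers r"
    then obtain p k where x: "x = (p, k)" and p: "p \<in> monic_irreducibles (degree p)"
      and k: "k > 0" "k * degree p = r"
      by (auto simp: prime_powers_def)
    have d: "degree p > 0" using monic_irreducibles_degree[OF p] by simp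
    show "x \<in> ?A \<union> ?B"
    proof (cases "k = 1")
      case True then show ?thesis using x p k by auto
    next
      case False
      then have "2 * degree p \<le> k * degree p" using k(1) by (intro mult_right_mono) auto
      then have "degree p \<in> {1..r div 2}" using k d by auto
      moreover have "k = r div degree p" using k d by auto
      ultimately have "x \<in> ?B" using x p by blast
      then show ?thesis by blast
    qed
  qed
  have "CARD('a) ^ r = (\<Sum>x\<in>(prime_powers r :: ('a poly \<times> nat) set). degree (fst x))"
    using sum_degree_prime_powers[OF assms, where 'a='a] by simp
  also have "\<dots> \<le> (\<Sum>x\<in>?A \<union> ?B. degree (fst x))"
    by (intro sum_mono2 sub) (use fin in auto)
  also have "\<dots> \<le> (\<Sum>x\<in>?A. degree (fst x)) + (\<Sum>x\<in>?B. degree (fst x))"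
    using sum.union_inter[OF fin, of "\<lambda>x. degree (fst x)"] by linarith
  also have "(\<Sum>x\<in>?A. degree (fst x)) = r * card (monic_irreducibles r :: 'a poly set)"
    by (subst sum.reindex) (auto intro!: inj_onI simp: monic_irreducibles_degree(1))
  also have "(\<Sum>x\<in>?B. degree (fst x)) = (\<Sum>p\<in>(\<Union>d\<in>{1..r div 2}. monic_irreducibles d :: 'a poly set). degree p)"
    by (subst sum.reindex) (auto intro!: inj_onI)
  also have "\<dots> = (\<Sum>d\<in>{1..r div 2}. \<Sum>p\<in>(monic_irreducibles d :: 'a poly set). degree p)"
  proof (rule sum.UNION_disjoint)
    show "\<forall>i\<in>{1..r div 2}. \<forall>j\<in>{1..r div 2}. i \<noteq> j \<longrightarrow>
        (monic_irreducibles i :: 'a poly set) \<inter> monic_irreducibles j = {}"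
    proof (intro ballI impI equals0I)
      fix i j and p :: "'a poly"
      assume "i \<noteq> j" "p \<in> monic_irreducibles i \<inter> monic_irreducibles j"
      then show False using monic_irreducibles_degree(1)[of p i] monic_irreducibles_degree(1)[of p j] by simp
    qed
  qed (simp_all add: finite_monic_irreducibles)
  also have "\<dots> = (\<Sum>d\<in>{1..r div 2}. d * card (monic_irreducibles d :: 'a poly set))"
    by (auto simp: monic_irreducibles_degree(1) intro!: sum.cong)
  also have "\<dots> \<le> (\<Sum>d\<in>{1..r div 2}. CARD('a) ^ d)"
    by (intro sum_mono card_monic_irreducibles_upper) auto
  finally show ?thesis by simp
qed

subsection \<open>Coordinate vectors as polynomials of bounded degree\<close>

lemma coeff_vec_poly:
  "poly.coeff (vec_poly cs v) i = (if i < length cs then Finite_Cartesian_Product.vec_nth v (cs ! i) else 0)"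
  by (simp add: vec_poly_def coeff_Poly_eq nth_default_def)

lemma vec_poly_add: "vec_poly cs (v + w) = vec_poly cs v + vec_poly cs w"
  by (rule poly_eqI) (simp add: coeff_vec_poly)

lemma vec_poly_scale: "vec_poly cs (c *s v) = Polynomial.smult c (vec_poly cs v)"
  by (rule poly_eqI) (simp add: coeff_vec_poly)

lemma vec_poly_0 [simp]: "vec_poly cs 0 = 0"
  by (rule poly_eqI) (simp add: coeff_vec_poly)

lemma vec_poly_diff: "vec_poly cs (v - w) = vec_poly cs v - vec_poly cs w"
  by (rule poly_eqI) (simp add: coeff_vec_poly)

lemma vec_poly_sum: "vec_poly cs (\<Sum>i\<in>I. f i) = (\<Sum>i\<in>I. vec_poly cs (f i))"
  by (induction I rule: infinite_finite_induct) (auto simp: vec_poly_add)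

locale coordinates =
  fixes cs :: "'m::finite list"
  assumes distinct_coords: "distinct cs" and set_coords: "set cs = UNIV"
begin

lemma length_coords: "length cs = CARD('m)"
  using distinct_card[OF distinct_coords] set_coords by simp

lemma vec_poly_eq_0_iff [simp]: "vec_poly cs v = 0 \<longleftrightarrow> v = 0"
proof
  assume v: "vec_poly cs v = 0"
  show "v = 0"
  proof (rule Finite_Cartesian_Product.vec_eq_iff[THEN iffD2], rule allI)
    fix c
    obtain i where "i < length cs" "cs ! i = c" using set_coords by (metis UNIV_I in_set_conv_nth)
    then show "Finite_Cartesian_Product.vec_nth v c = Finite_Cartesian_Product.vec_nth 0 c"
      using v coeff_vec_poly[of cs v i] by simp
  qed
qed simp

lemma degree_vec_poly: "v \<noteq> 0 \<Longrightarrow> degree (vec_poly cs v) < CARD('m)"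
  by (metis coeff_vec_poly leading_coeff_0_iff length_coords vec_poly_eq_0_iff)

lemma obtain_vec_poly:
  assumes "f = 0 \<or> degree f < CARD('m)"
  obtains v where "vec_poly cs v = f"
proof
  define v where "v = Finite_Cartesian_Product.vec_lambda (\<lambda>c. poly.coeff f (THE i. i < length cs \<and> cs ! i = c))"
  show "vec_poly cs v = f"
  proof (rule poly_eqI)
    fix i
    show "poly.coeff (vec_poly cs v) i = poly.coeff f i"
    proof (cases "i < length cs")
      case True
      then have "(THE j. j < length cs \<and> cs ! j = cs ! i) = i"
        using distinct_coords by (auto intro!: the_equality simp: nth_eq_iff_index_eq)
      then show ?thesis using True by (simp add: coeff_vec_poly v_def)
    next
      case False
      then show ?thesis using assms by (auto simp: coeff_vec_poly length_coords intro: coeff_eq_0)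
    qed
  qed
qed

section \<open>Degree sets of subspaces and echelon bases\<close>

definition degrees :: "('a::field ^ 'm) set \<Rightarrow> nat set" where
  "degrees W = (\<lambda>v. degree (vec_poly cs v)) ` (W - {0})"

lemma degrees_less: "degrees W \<subseteq> {..<CARD('m)}"
  using degree_vec_poly by (auto simp: degrees_def)

lemma finite_degrees: "finite (degrees W)"
  by (rule finite_subset[OF degrees_less]) simp

lemma subspace_degree_less:
  "vec.subspace {v :: 'a::field ^ 'm. v = 0 \<or> degree (vec_poly cs v) < n}"
proof (rule vec.subspaceI)
  fix x y :: "'a ^ 'm"
  assume "x \<in> {v. v = 0 \<or> degree (vec_poly cs v) < n}" "y \<in> {v. v = 0 \<or> degree (vec_poly cs v) < n}"
  then show "x + y \<in> {v. v = 0 \<or> degree (vec_poly cs v) < n}"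
    by (auto simp: vec_poly_add intro: degree_add_less)
next
  fix c :: 'a and x :: "'a ^ 'm"
  assume "x \<in> {v. v = 0 \<or> degree (vec_poly cs v) < n}"
  then show "c *s x \<in> {v. v = 0 \<or> degree (vec_poly cs v) < n}"
    using degree_smult_le[of c "vec_poly cs x"] by (auto simp: vec_poly_scale)
qed simp

text \<open>Insert the vectors by increasing degree: apart from 0, the span of the earlier ones
  contains only polynomials of smaller degree.\<close>

lemma independent_degree_distinct:
  assumes "finite D" "\<And>d. d \<in> D \<Longrightarrow> e d \<noteq> 0 \<and> degree (vec_poly cs (e d)) = d"
  shows "vec.independent (e ` D :: ('a::field ^ 'm) set)"
  using assms
proof (induction D rule: finite_linorder_max_induct)
  case empty then show ?case by (simp add: vec.independent_empty)
next
  case (insert d D)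
  have "e ` D \<subseteq> {v. v = 0 \<or> degree (vec_poly cs v) < d}"
    using insert.hyps insert.prems by auto
  then have "vec.span (e ` D) \<subseteq> {v. v = 0 \<or> degree (vec_poly cs v) < d}"
    by (rule vec.span_minimal) (rule subspace_degree_less)
  moreover have "e d \<notin> {v. v = 0 \<or> degree (vec_poly cs v) < d}"
    using insert.prems by auto
  ultimately have "e d \<notin> vec.span (e ` D)" by blast
  moreover have "vec.independent (e ` D)" using insert.IH insert.prems by blast
  ultimately show ?case by (simp add: vec.independent_insertI)
qed

text \<open>Gaussian elimination on leading coefficients: subtracting a multiple of the basis vector
  of the same degree gives 0 or lowers the degree.\<close>

lemma span_degree_distinct:
  assumes W: "vec.subspace W"
    and e: "\<And>d. d \<in> degrees W \<Longrightarrow> e d \<in> W - {0} \<and> degree (vec_poly cs (e d)) = d"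
  shows "W \<subseteq> vec.span (e ` degrees W :: ('a::field ^ 'm) set)"
proof
  fix v assume "v \<in> W"
  then show "v \<in> vec.span (e ` degrees W)"
  proof (induction "degree (vec_poly cs v)" arbitrary: v rule: less_induct)
    case less
    show ?case
    proof (cases "v = 0")
      case True then show ?thesis by (simp add: vec.span_zero)
    next
      case False
      define n where "n = degree (vec_poly cs v)"
      have n: "n \<in> degrees W" using False less.prems by (auto simp: degrees_def n_def)
      define c where "c = lead_coeff (vec_poly cs v) / lead_coeff (vec_poly cs (e n))"
      define u where "u = v - c *s e n"
      have uW: "u \<in> W" using W e[OF n] less.prems unfolding u_def
        by (intro vec.subspace_diff vec.subspace_scale) auto
      have "vec_poly cs (e n) \<noteq> 0" using e[OF n] by simp
      then have lc: "lead_coeff (vec_poly cs (e n)) \<noteq> 0" by (rule leading_coeff_neq_0)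
      have pu: "vec_poly cs u = vec_poly cs v - Polynomial.smult c (vec_poly cs (e n))"
        by (simp add: u_def vec_poly_diff vec_poly_scale)
      have "u = 0 \<or> degree (vec_poly cs u) < n"
      proof (cases "u = 0")
        case False
        have "degree (vec_poly cs u) \<le> n" unfolding pu
          using e[OF n] by (intro degree_diff_le order.trans[OF degree_smult_le]) (auto simp: n_def)
        moreover have "poly.coeff (vec_poly cs u) n = 0"
        proof -
          have "poly.coeff (vec_poly cs (e n)) n \<noteq> 0" using lc e[OF n] by simp
          moreover have "c = poly.coeff (vec_poly cs v) n / poly.coeff (vec_poly cs (e n)) n"
            using e[OF n] by (simp add: c_def n_def)
          ultimately show ?thesis by (simp add: pu)
        qed
        ultimately show ?thesis using False
          by (metis le_neq_implies_less leading_coeff_0_iff vec_poly_eq_0_iff)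
      qed simp
      then have "u \<in> vec.span (e ` degrees W)"
        using less.hyps[of u] uW by (auto simp: n_def vec.span_zero)
      moreover have "c *s e n \<in> vec.span (e ` degrees W)"
        using n by (intro vec.span_scale vec.span_base) auto
      ultimately have "u + c *s e n \<in> vec.span (e ` degrees W)" by (rule vec.span_add)
      then show ?thesis by (simp add: u_def)
    qed
  qed
qed

lemma obtain_degree_distinct_basis:
  obtains e where "\<And>d. d \<in> degrees W \<Longrightarrow> e d \<in> W - {0} \<and> degree (vec_poly cs (e d)) = d"
proof -
  have "\<forall>d\<in>degrees W. \<exists>v. v \<in> W - {0} \<and> degree (vec_poly cs v) = d" by (auto simp: degrees_def)
  then show thesis using that by metis
qed

text \<open>One vector for each occurring degree forms a basis; the degrees are the pivot positions
  of an echelon form.\<close>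

lemma card_degrees:
  assumes W: "vec.subspace (W :: ('a::field ^ 'm) set)"
  shows "card (degrees W) = vec.dim W"
proof -
  obtain e where e: "\<And>d. d \<in> degrees W \<Longrightarrow> e d \<in> W - {0} \<and> degree (vec_poly cs (e d)) = d"
    using obtain_degree_distinct_basis by blast
  have "inj_on e (degrees W)" using e by (metis inj_on_def)
  then have "card (e ` degrees W) = card (degrees W)" by (rule card_image)
  moreover have "vec.independent (e ` degrees W)"
    using e by (intro independent_degree_distinct finite_degrees) auto
  moreover have "e ` degrees W \<subseteq> W" using e by auto
  ultimately show ?thesis using span_degree_distinct[OF W e]
    by (metis vec.dim_unique)
qed

section \<open>Multiples of a fixed polynomial\<close>

definition multiples :: "'a::field poly \<Rightarrow> ('a ^ 'm) set" where
  "multiples D = {v. D dvd vec_poly cs v}"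

lemma subspace_multiples: "vec.subspace (multiples D)"
  by (rule vec.subspaceI) (auto simp: multiples_def vec_poly_add vec_poly_scale intro: dvd_smult)

text \<open>The products of \<open>D\<close> with monomials reach every degree from
  \<open>degree D\<close> to \<open>CARD('m) - 1\<close>.\<close>

lemma degrees_multiples:
  assumes "D \<noteq> 0" shows "degrees (multiples D) = {degree D..<CARD('m)}"
proof (intro equalityI subsetI)
  fix d assume "d \<in> degrees (multiples D)"
  then obtain v where v: "v \<noteq> 0" "D dvd vec_poly cs v" "d = degree (vec_poly cs v)"
    by (auto simp: degrees_def multiples_def)
  then show "d \<in> {degree D..<CARD('m)}"
    using degree_vec_poly[of v] dvd_imp_degree_le[of D "vec_poly cs v"] by simp
next
  fix d assume d: "d \<in> {degree D..<CARD('m)}"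
  have deg: "degree (D * Polynomial.monom 1 (d - degree D)) = d"
    using assms d by (simp add: degree_mult_eq degree_monom_eq)
  then obtain v where v: "vec_poly cs v = D * Polynomial.monom 1 (d - degree D)"
    using obtain_vec_poly[of "D * Polynomial.monom 1 (d - degree D)"] d by auto
  have "vec_poly cs v \<noteq> 0" using assms by (simp add: v)
  then have "v \<in> multiples D - {0}" using v by (auto simp: multiples_def)
  then show "d \<in> degrees (multiples D)" using deg v by (force simp: degrees_def)
qed

text \<open>The minimum appears because the space of multiples is zero once
  \<open>degree D \<ge> CARD('m)\<close>.\<close>

lemma codim_multiples:
  assumes "D \<noteq> 0" shows "codim (multiples D) = min (degree D) CARD('m)"
  using card_degrees[OF subspace_multiples[of D]] by (simp add: codim_def degrees_multiples[OF assms])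

end

subsection \<open>Determinants with polynomial entries\<close>

text \<open>Here \<open>a\<close> and \<open>b\<close> are only upper bounds: formal leading
  coefficients multiply even when they vanish.\<close>

lemma coeff_mult_degree_le:
  fixes f g :: "'a::comm_semiring_1 poly"
  assumes "degree f \<le> a" "degree g \<le> b"
  shows "poly.coeff (f * g) (a + b) = poly.coeff f a * poly.coeff g b"
proof -
  have "poly.coeff (f * g) (a + b) = (\<Sum>i\<le>a + b. poly.coeff f i * poly.coeff g (a + b - i))"
    by (rule coeff_mult)
  also have "\<dots> = (\<Sum>i\<le>a + b. if i = a then poly.coeff f a * poly.coeff g b else 0)"
  proof (rule sum.cong)
    fix i assume "i \<in> {..a + b}"
    show "poly.coeff f i * poly.coeff g (a + b - i) = (if i = a then poly.coeff f a * poly.coeff g b else 0)"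
    proof (cases i a rule: linorder_cases)
      case less
      then have "poly.coeff g (a + b - i) = 0" using assms by (intro coeff_eq_0) auto
      then show ?thesis using less by simp
    next
      case greater
      then have "poly.coeff f i = 0" using assms by (intro coeff_eq_0) auto
      then show ?thesis using greater by simp
    qed simp
  qed simp
  finally show ?thesis by simp
qed

lemma degree_coeff_prod_le:
  fixes f :: "'i \<Rightarrow> 'a::comm_semiring_1 poly"
  assumes "finite I" "\<And>i. i \<in> I \<Longrightarrow> degree (f i) \<le> n i"
  shows "degree (prod f I) \<le> sum n I \<and> poly.coeff (prod f I) (sum n I) = (\<Prod>i\<in>I. poly.coeff (f i) (n i))"
  using assms
proof (induction I rule: finite_induct)
  case (insert i I)
  then have "degree (f i) \<le> n i" and IH: "degree (prod f I) \<le> sum n I"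
    "poly.coeff (prod f I) (sum n I) = (\<Prod>i\<in>I. poly.coeff (f i) (n i))" by auto
  then have "degree (f i * prod f I) \<le> n i + sum n I"
    using degree_mult_le[of "f i" "prod f I"] by linarith
  then show ?case using insert coeff_mult_degree_le[OF \<open>degree (f i) \<le> n i\<close> IH(1)] IH by simp
qed simp

lemma permutes_atLeast0_less: "p permutes {0..<s::nat} \<Longrightarrow> i < s \<Longrightarrow> p i < s"
  using permutes_in_image[of p "{0..<s}" i] by simp

lemma det_mat:
  "Determinant.det (mat s s A) = (\<Sum>p\<in>{p. p permutes {0..<s}}. signof p * (\<Prod>i=0..<s. A (i, p i)))"
  by (subst det_def'[of _ s]) (auto intro!: sum.cong prod.cong simp: permutes_atLeast0_less)

lemma signof_poly: "(signof p :: 'a::comm_ring_1 poly) = [:signof p:]"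
  by (simp add: of_int_poly)

text \<open>Each Leibniz term takes one entry from every row, so all terms share the bound
  \<open>sum a {0..<s}\<close>, and their coefficients in that degree form the Leibniz expansion of
  the determinant on the right.\<close>

lemma degree_coeff_det_le:
  fixes A :: "nat \<times> nat \<Rightarrow> 'a::comm_ring_1 poly"
  assumes "\<And>i j. i < s \<Longrightarrow> j < s \<Longrightarrow> degree (A (i, j)) \<le> a i"
  shows "degree (Determinant.det (mat s s A)) \<le> sum a {0..<s}"
    and "poly.coeff (Determinant.det (mat s s A)) (sum a {0..<s})
           = Determinant.det (mat s s (\<lambda>(i, j). poly.coeff (A (i, j)) (a i)))"
proof -
  have *: "degree (\<Prod>i=0..<s. A (i, p i)) \<le> sum a {0..<s} \<and>
      poly.coeff (\<Prod>i=0..<s. A (i, p i)) (sum a {0..<s}) = (\<Prod>i=0..<s. poly.coeff (A (i, p i)) (a i))"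
    if "p permutes {0..<s}" for p
    by (rule degree_coeff_prod_le) (use assms permutes_atLeast0_less[OF that] in auto)
  show "degree (Determinant.det (mat s s A)) \<le> sum a {0..<s}"
    unfolding det_mat using *
    by (intro degree_sum_le) (auto simp: signof_poly finite_permutations intro: order.trans[OF degree_smult_le])
  show "poly.coeff (Determinant.det (mat s s A)) (sum a {0..<s})
      = Determinant.det (mat s s (\<lambda>(i, j). poly.coeff (A (i, j)) (a i)))"
    unfolding det_mat coeff_sum using * by (auto intro!: sum.cong simp: signof_poly)
qed

lemma det_scale_columns:
  "Determinant.det (mat s s (\<lambda>(i, j). c j * A (i, j))) = (\<Prod>j=0..<s. c j) * Determinant.det (mat s s A)"
proof -
  have "(\<Prod>i=0..<s. c (p i)) = (\<Prod>j=0..<s. c j)" if "p permutes {0..<s}" for p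
    using prod.permute[OF that, of c] by simp
  then show ?thesis
    unfolding det_mat sum_distrib_left by (auto intro!: sum.cong simp: prod.distrib)
qed

text \<open>Each Leibniz term has a factor from each of the first \<open>d\<close> rows, and all of
  these are divisible by \<open>D\<close>.\<close>

lemma power_dvd_det:
  fixes A :: "nat \<times> nat \<Rightarrow> 'a::comm_ring_1"
  assumes "d \<le> s" "\<And>i j. i < d \<Longrightarrow> j < s \<Longrightarrow> D dvd A (i, j)"
  shows "D ^ d dvd Determinant.det (mat s s A)"
  unfolding det_mat
proof (rule dvd_sum, rule dvd_mult)
  fix p assume "p \<in> {p. p permutes {0..<s}}"
  then have p: "p permutes {0..<s}" by simp
  have "(\<Prod>i=0..<d. D) dvd (\<Prod>i=0..<d. A (i, p i))"
    using assms permutes_atLeast0_less[OF p] by (intro prod_dvd_prod) auto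
  also have "\<dots> dvd (\<Prod>i=0..<s. A (i, p i))"
    using assms(1) by (intro prod_dvd_prod_subset) auto
  finally show "D ^ d dvd (\<Prod>i=0..<s. A (i, p i))" by simp
qed

lemma sum_monic_eq_0_imp:
  fixes P :: "nat \<Rightarrow> 'a::field poly"
  assumes "\<And>j. degree (P j) = j \<and> lead_coeff (P j) = 1" "(\<Sum>j<s. Polynomial.smult (c j) (P j)) = 0"
  shows "\<forall>j<s. c j = 0"
  using assms(2)
proof (induction s)
  case (Suc s)
  have "poly.coeff (P j) s = 0" if "j < s" for j using that assms(1) by (simp add: coeff_eq_0)
  moreover have "poly.coeff (P s) s = 1" using assms(1)[of s] by metis
  ultimately have "poly.coeff (\<Sum>j<Suc s. Polynomial.smult (c j) (P j)) s = c s"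
    by (simp add: coeff_sum)
  then have "c s = 0" unfolding Suc.prems by simp
  then show ?case using Suc by (simp add: less_Suc_eq)
qed simp

text \<open>A kernel vector lists the coordinates, with respect to
  \<open>P 0, ..., P (s - 1)\<close>, of a polynomial of degree below \<open>s\<close> with the
  \<open>s\<close> distinct roots \<open>x i\<close>. That polynomial is zero, and so is the vector
  because the degrees of the \<open>P j\<close> are distinct.\<close>

lemma generalized_vandermonde_nonzero:
  fixes P :: "nat \<Rightarrow> 'a::field poly"
  assumes P: "\<And>j. degree (P j) = j \<and> lead_coeff (P j) = 1" and x: "inj_on x {..<s}"
  shows "Determinant.det (mat s s (\<lambda>(i, j). poly (P j) (x i))) \<noteq> 0"
proof
  let ?A = "mat s s (\<lambda>(i, j). poly (P j) (x i))"
  assume "Determinant.det ?A = 0"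
  then obtain v where v: "v \<in> carrier_vec s" "v \<noteq> 0\<^sub>v s" "?A *\<^sub>v v = 0\<^sub>v s"
    using det_0_iff_vec_prod_zero[of ?A s] by auto
  define Q where "Q = (\<Sum>j<s. Polynomial.smult (vec_index v j) (P j))"
  have root: "poly Q (x i) = 0" if "i < s" for i
  proof -
    have "vec_index (?A *\<^sub>v v) i = (\<Sum>j<s. poly (P j) (x i) * vec_index v j)"
      using that v(1) by (simp add: scalar_prod_def lessThan_atLeast0)
    then show ?thesis using v(3) that by (simp add: Q_def poly_sum mult.commute)
  qed
  have "Q = 0"
  proof (rule ccontr)
    assume Q: "Q \<noteq> 0"
    then have "s > 0" by (auto simp: Q_def intro: Nat.gr0I)
    have "degree Q \<le> s - 1" unfolding Q_def
      using P by (intro degree_sum_le) (auto intro: order.trans[OF degree_smult_le])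
    have "card (x ` {..<s}) \<le> card {y. poly Q y = 0}"
      using root Q by (intro card_mono poly_roots_finite) auto
    also have "\<dots> \<le> degree Q" by (rule card_poly_roots_bound[OF Q])
    finally show False using \<open>degree Q \<le> s - 1\<close> \<open>s > 0\<close> by (simp add: card_image[OF x])
  qed
  then have "\<forall>j<s. vec_index v j = 0"
    using sum_monic_eq_0_imp[OF P, where c = "vec_index v"] by (simp add: Q_def)
  then show False using v(1,2) by auto
qed

text \<open>The extremal set consists of the \<open>card A\<close> largest numbers below
  \<open>m\<close>.\<close>

lemma sum_le_descending:
  assumes "A \<subseteq> {..<m}"
  shows "\<Sum>A \<le> (\<Sum>i<card A. m - 1 - i)"
  using assms
proof (induction m arbitrary: A)
  case (Suc m)
  have fin: "finite A" using Suc.prems finite_subset by blast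
  show ?case
  proof (cases "m \<in> A")
    case True
    have "\<Sum>(A - {m}) \<le> (\<Sum>i<card (A - {m}). m - 1 - i)"
      using Suc.prems by (intro Suc.IH) auto
    moreover have "\<Sum>A = m + \<Sum>(A - {m})" using True fin by (simp add: sum.remove)
    moreover have "card A = Suc (card (A - {m}))" using True fin by (metis card.remove)
    moreover have "(\<Sum>i<Suc k. Suc m - 1 - i) = m + (\<Sum>i<k. m - 1 - i)" for k
      by (subst sum.lessThan_Suc_shift) simp
    ultimately show ?thesis by (metis add_left_mono)
  next
    case False
    then have "\<Sum>A \<le> (\<Sum>i<card A. m - 1 - i)"
      using Suc.prems by (intro Suc.IH) (auto simp: less_Suc_eq)
    also have "\<dots> \<le> (\<Sum>i<card A. Suc m - 1 - i)" by (rule sum_mono) simp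
    finally show ?thesis .
  qed
qed simp

subsection \<open>Generalized Wronskians\<close>

text \<open>
  The operator \<open>L j\<close> lowers degrees by \<open>b j\<close>. Stating its effect for
  \<open>X ^ b j * L j f\<close> instead avoids truncated subtraction when \<open>degree f < b j\<close>.
  The leading coefficients then form a generalized Vandermonde matrix at the points
  \<open>x (degree (f i))\<close>.
\<close>
locale wronskian_operators = coordinates cs
  for cs :: "'m::finite list" +
  fixes L :: "nat \<Rightarrow> 'a::field poly \<Rightarrow> 'a poly" and b :: "nat \<Rightarrow> nat"
    and P :: "nat \<Rightarrow> 'a poly" and x :: "nat \<Rightarrow> 'a"
  assumes L_add: "L j (f + g) = L j f + L j g"
    and L_smult: "L j (Polynomial.smult c f) = Polynomial.smult c (L j f)"
    and P: "degree (P j) = j \<and> lead_coeff (P j) = 1"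
    and x: "inj_on x {..<CARD('m)}"
    and degree_L: "degree (Polynomial.monom 1 (b j) * L j f) \<le> degree f"
    and coeff_L: "poly.coeff (Polynomial.monom 1 (b j) * L j f) (degree f)
                    = lead_coeff f * poly (P j) (x (degree f))"
begin

lemma L_0: "L j 0 = 0"
  using L_smult[of j 0 0] by simp

lemma L_sum: "L j (\<Sum>i\<in>I. f i) = (\<Sum>i\<in>I. L j (f i))"
  by (induction I rule: infinite_finite_induct) (auto simp: L_0 L_add)

definition wronskian :: "nat \<Rightarrow> (nat \<Rightarrow> 'a poly) \<Rightarrow> 'a poly" where
  "wronskian s f = Determinant.det (mat s s (\<lambda>(i, j). L j (f i)))"

text \<open>The operators commute with constant linear combinations, so the two matrices differ by a
  left factor with constant entries. This carries divisors found in an adapted basis over to a fixed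
  Wronskian.\<close>

lemma wronskian_dvd:
  assumes "\<And>i. i < s \<Longrightarrow> f i = (\<Sum>k<s. Polynomial.smult (c i k) (h k))"
  shows "wronskian s h dvd wronskian s f"
proof -
  let ?C = "mat s s (\<lambda>(i, k). [:c i k:])" and ?H = "mat s s (\<lambda>(i, j). L j (h i))"
  have "mat s s (\<lambda>(i, j). L j (f i)) = ?C * ?H"
    by (rule eq_matI) (auto simp: assms L_sum L_smult scalar_prod_def lessThan_atLeast0)
  then have "wronskian s f = Determinant.det ?C * wronskian s h"
    using det_mult[of ?C s ?H] by (simp add: wronskian_def)
  then show ?thesis by simp
qed

text \<open>Multiplying column \<open>j\<close> by \<open>X ^ b j\<close> gives row \<open>i\<close>
  the degree bound \<open>degree (f i)\<close>. The formal top coefficient is then the product of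
  the leading coefficients and a generalized Vandermonde determinant, whose points are distinct
  because the degrees are. Removing the monomial again lowers the degree by the sum of the
  \<open>b j\<close>.\<close>

lemma wronskian_distinct_degrees:
  assumes inj: "inj_on (\<lambda>i. degree (f i)) {..<s}" and f: "\<And>i. i < s \<Longrightarrow> f i \<noteq> 0 \<and> degree (f i) < CARD('m)"
  shows "wronskian s f \<noteq> 0"
    and "degree (wronskian s f) + (\<Sum>j<s. b j) \<le> (\<Sum>i<s. degree (f i))"
proof -
  let ?A = "\<lambda>(i, j). Polynomial.monom 1 (b j) * L j (f i)"
  let ?V = "\<lambda>(i, j). poly (P j) (x (degree (f i)))"
  have monom: "(\<Prod>j=0..<s. Polynomial.monom (1::'a) (b j)) = Polynomial.monom 1 (\<Sum>j<s. b j)"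
    by (induction s) (simp_all add: mult_monom monom_0 one_pCons)
  have shift: "Determinant.det (mat s s ?A) = Polynomial.monom 1 (\<Sum>j<s. b j) * wronskian s f"
    using det_scale_columns[of s "\<lambda>j. Polynomial.monom 1 (b j)" "\<lambda>(i, j). L j (f i)"]
    by (simp add: wronskian_def monom case_prod_unfold)
  have le: "\<And>i j. i < s \<Longrightarrow> j < s \<Longrightarrow> degree (?A (i, j)) \<le> degree (f i)" by (simp add: degree_L)
  have "poly.coeff (Determinant.det (mat s s ?A)) (\<Sum>i=0..<s. degree (f i))
      = Determinant.det (mat s s (\<lambda>(i, j). poly.coeff (?A (i, j)) (degree (f i))))"
    by (rule degree_coeff_det_le(2)) (rule le)
  \<comment> \<open>The leading coefficients are row factors; transposing makes them column factors,
    as \<open>det_scale_columns\<close> expects.\<close>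
  also have "\<dots> = Determinant.det (Matrix.transpose_mat (mat s s (\<lambda>(i, j). poly.coeff (?A (i, j)) (degree (f i)))))"
    by (rule det_transpose[of _ s, symmetric]) simp
  also have "Matrix.transpose_mat (mat s s (\<lambda>(i, j). poly.coeff (?A (i, j)) (degree (f i))))
      = mat s s (\<lambda>(i, j). lead_coeff (f j) * (\<lambda>(i, j). ?V (j, i)) (i, j))"
    by (rule eq_matI) (auto simp: coeff_L)
  also have "Determinant.det \<dots> = (\<Prod>i=0..<s. lead_coeff (f i)) * Determinant.det (mat s s (\<lambda>(i, j). ?V (j, i)))"
    by (rule det_scale_columns)
  also have "Determinant.det (mat s s (\<lambda>(i, j). ?V (j, i))) = Determinant.det (Matrix.transpose_mat (mat s s ?V))"
    by (rule arg_cong[of _ _ Determinant.det], rule eq_matI) auto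
  also have "\<dots> = Determinant.det (mat s s ?V)" by (rule det_transpose[of _ s]) simp
  finally have coeff: "poly.coeff (Determinant.det (mat s s ?A)) (\<Sum>i=0..<s. degree (f i))
      = (\<Prod>i=0..<s. lead_coeff (f i)) * Determinant.det (mat s s ?V)" .
  have "inj_on (\<lambda>i. x (degree (f i))) {..<s}"
    using comp_inj_on[OF inj, of x] inj_on_subset[OF x] f by (simp add: image_subset_iff comp_def)
  then have "Determinant.det (mat s s ?V) \<noteq> 0" by (rule generalized_vandermonde_nonzero[OF P])
  moreover have "(\<Prod>i=0..<s. lead_coeff (f i)) \<noteq> 0" using f by simp
  ultimately have "Determinant.det (mat s s ?A) \<noteq> 0" using coeff by auto
  then show W: "wronskian s f \<noteq> 0" using shift by auto
  have "degree (Determinant.det (mat s s ?A)) \<le> (\<Sum>i=0..<s. degree (f i))"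
    by (rule degree_coeff_det_le(1)) (rule le)
  then show "degree (wronskian s f) + (\<Sum>j<s. b j) \<le> (\<Sum>i<s. degree (f i))"
    using W by (simp add: shift degree_mult_eq degree_monom_eq lessThan_atLeast0 add.commute)
qed

text \<open>A single \<Omega>, the Wronskian of a basis with distinct degrees, has to serve all
  \<open>H\<close> and \<open>D\<close> at once, since the divisors from different members of the
  collection are later multiplied together.\<close>

lemma obtain_subspace_wronskian:
  assumes W: "vec.subspace W" "vec.dim W = s"
  obtains \<Omega> where "\<Omega> \<noteq> 0" "degree \<Omega> + (\<Sum>j<s. b j) \<le> (\<Sum>i<s. CARD('m) - 1 - i)"
    "\<And>H D. vec.subspace H \<Longrightarrow> (\<And>v j. v \<in> H \<Longrightarrow> j < s \<Longrightarrow> D dvd L j (vec_poly cs v)) \<Longrightarrow>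
       D ^ vec.dim (H \<inter> W) dvd \<Omega>"
proof -
  have card: "card (degrees W) = s" using card_degrees[OF W(1)] W(2) by simp
  obtain e where e: "\<And>d. d \<in> degrees W \<Longrightarrow> e d \<in> W - {0} \<and> degree (vec_poly cs (e d)) = d"
    using obtain_degree_distinct_basis by blast
  obtain a where a: "bij_betw a {..<s} (degrees W)"
    using ex_bij_betw_nat_finite[OF finite_degrees] card by (metis lessThan_atLeast0)
  define f where "f = (\<lambda>i. vec_poly cs (e (a i)))"
  have aD: "a i \<in> degrees W" if "i < s" for i using a that by (auto simp: bij_betw_def)
  have deg: "degree (f i) = a i" if "i < s" for i using e aD that by (simp add: f_def)
  have fm: "f i \<noteq> 0 \<and> degree (f i) < CARD('m)" if "i < s" for i
    using e[OF aD[OF that]] degree_vec_poly[of "e (a i)"] by (auto simp: f_def)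
  have inj: "inj_on (\<lambda>i. degree (f i)) {..<s}"
    using a deg by (auto simp: bij_betw_def inj_on_def)
  have sum: "(\<Sum>i<s. degree (f i)) = \<Sum>(degrees W)"
    using sum.reindex_bij_betw[OF a, of "\<lambda>x. x"] deg by simp
  have "D ^ vec.dim (H \<inter> W) dvd wronskian s f"
    if H: "vec.subspace H" and D: "\<And>v j. v \<in> H \<Longrightarrow> j < s \<Longrightarrow> D dvd L j (vec_poly cs v)" for H D
  proof -
    obtain B1 where B1: "B1 \<subseteq> H \<inter> W" "vec.independent B1" "card B1 = vec.dim (H \<inter> W)"
      using vec.basis_exists[of "H \<inter> W"] by metis
    obtain B2 where B2: "B1 \<subseteq> B2" "B2 \<subseteq> W" "vec.independent B2" "W \<subseteq> vec.span B2"
      using vec.maximal_independent_subset_extend[of B1 W] B1 by blast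
    have fin: "finite B2" using B2(3) vec.finiteI_independent by blast
    have cB2: "card B2 = s" using vec.basis_card_eq_dim[OF B2(2,4,3)] W(2) by simp
    define d where "d = card B1"
    have ds: "d \<le> s" using card_mono[OF fin B2(1)] cB2 d_def by simp
    obtain xs ys where xs: "set xs = B1" "distinct xs" and ys: "set ys = B2 - B1" "distinct ys"
      using finite_distinct_list fin B2(1) by (metis finite_Diff finite_subset)
    \<comment> \<open>Listing the basis of \<open>H \<inter> W\<close> first puts the rows divisible
      by \<open>D\<close> at the top of the matrix.\<close>
    define zs where "zs = xs @ ys"
    have zs: "distinct zs" "set zs = B2" using xs ys B2(1) by (auto simp: zs_def)
    have lz: "length zs = s" using distinct_card[OF zs(1)] zs(2) cB2 by simp
    have lx: "length xs = d" using distinct_card[OF xs(2)] xs(1) d_def by simp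
    have bij: "bij_betw (\<lambda>k. zs ! k) {..<s} B2" using bij_betw_nth[OF zs(1), of "{..<s}" B2] zs lz by simp
    have "\<exists>u. e (a i) = (\<Sum>v\<in>B2. u v *s v)" if "i < s" for i
    proof -
      have "e (a i) \<in> vec.span B2" using e[OF aD[OF that]] B2(4) by auto
      then show ?thesis using vec.span_finite[OF fin] by auto
    qed
    then obtain u where u: "\<And>i. i < s \<Longrightarrow> e (a i) = (\<Sum>v\<in>B2. u i v *s v)" by metis
    have "wronskian s (\<lambda>k. vec_poly cs (zs ! k)) dvd wronskian s f"
    proof (rule wronskian_dvd)
      fix i assume "i < s"
      then have "f i = (\<Sum>v\<in>B2. Polynomial.smult (u i v) (vec_poly cs v))"
        by (simp add: f_def u vec_poly_sum vec_poly_scale)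
      also have "\<dots> = (\<Sum>k<s. Polynomial.smult (u i (zs ! k)) (vec_poly cs (zs ! k)))"
        by (rule sum.reindex_bij_betw[OF bij, symmetric])
      finally show "f i = \<dots>" .
    qed
    moreover have "D ^ d dvd wronskian s (\<lambda>k. vec_poly cs (zs ! k))"
      unfolding wronskian_def
    proof (rule power_dvd_det[OF ds])
      fix i j assume "i < d" "j < s"
      then have "zs ! i \<in> H" using lx xs(1) B1(1) by (metis IntD1 nth_append nth_mem subsetD zs_def)
      then show "D dvd (case (i, j) of (i, j) \<Rightarrow> L j (vec_poly cs (zs ! i)))"
        using D \<open>j < s\<close> by simp
    qed
    ultimately show ?thesis using B1(3) d_def by (metis dvd_trans)
  qed
  moreover have "degree (wronskian s f) + (\<Sum>j<s. b j) \<le> (\<Sum>i<s. CARD('m) - 1 - i)"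
    using wronskian_distinct_degrees(2)[OF inj fm] sum sum_le_descending[OF degrees_less, of W] card by simp
  ultimately show thesis using wronskian_distinct_degrees(1)[OF inj fm] that by blast
qed

end

subsection \<open>Primitive elements\<close>

text \<open>Presents the type-class field as a ring record, for which cyclicity of the finite
  multiplicative group is available.\<close>

lemma field_type_ring:
  "Ring.field \<lparr>carrier = UNIV :: 'a::field set, monoid.mult = (*), one = 1, zero = 0, add = (+)\<rparr>"
  (is "Ring.field ?R")
proof -
  have "cring ?R"
  proof (rule cringI)
    show "abelian_group ?R"
    proof (rule abelian_groupI)
      fix x :: 'a assume "x \<in> carrier ?R"
      show "\<exists>y\<in>carrier ?R. y \<oplus>\<^bsub>?R\<^esub> x = \<zero>\<^bsub>?R\<^esub>" by (simp, metis ab_left_minus)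
    qed (simp_all add: ac_simps)
    show "comm_monoid ?R" by (rule comm_monoidI) (simp_all add: ac_simps)
  qed (simp_all add: algebra_simps)
  then show ?thesis
  proof (rule cring.cring_fieldI2)
    fix a :: 'a assume "a \<in> carrier ?R" "a \<noteq> \<zero>\<^bsub>?R\<^esub>"
    then show "\<exists>b\<in>carrier ?R. a \<otimes>\<^bsub>?R\<^esub> b = \<one>\<^bsub>?R\<^esub>" by (simp, metis right_inverse)
  qed simp
qed

lemma ex_primitive_elem: "\<exists>g::'a::{finite,field}. range (\<lambda>k::nat. g ^ k) = - {0}"
proof -
  let ?R = "\<lparr>carrier = UNIV :: 'a set, monoid.mult = (*), one = 1, zero = 0, add = (+)\<rparr>"
  interpret R: Ring.field ?R by (rule field_type_ring)
  have pow: "a [^]\<^bsub>?R\<^esub> (k::nat) = a ^ k" for a :: 'a and k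
    by (induction k) (simp_all add: mult.commute)
  have "finite (carrier ?R)" by simp
  from R.finite_field_mult_group_has_gen[OF this] show ?thesis
  proof (rule bexE)
    fix g assume "carrier (mult_of ?R) = {g [^]\<^bsub>?R\<^esub> (i::nat) | i. i \<in> UNIV}"
    then have "- {0} = {g ^ i | i. True}" by (simp add: pow Compl_eq_Diff_UNIV)
    then show ?thesis by (auto simp: full_SetCompr_eq)
  qed
qed

lemma primitive_elem:
  assumes "set fs = UNIV"
  shows "range (\<lambda>k::nat. primitive_elem fs ^ k) = - {0 :: 'a::{finite,field}}"
proof -
  let ?gs = "filter (\<lambda>g::'a. range (\<lambda>k::nat. g ^ k) = - {0}) fs"
  have "?gs \<noteq> []" using ex_primitive_elem[where 'a='a] assms by (auto simp: filter_empty_conv)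
  then have "hd ?gs \<in> set ?gs" by (rule hd_in_set)
  then show ?thesis by (simp add: primitive_elem_def)
qed

locale primitive =
  fixes g :: "'a::{finite,field}"
  assumes range: "range (\<lambda>k::nat. g ^ k) = - {0}"
begin

lemma nonzero: "g \<noteq> 0"
  using rangeI[of "\<lambda>k::nat. g ^ k" 1] unfolding range by simp

text \<open>If \<open>g ^ k = 1\<close>, the powers of \<open>g\<close> take at most
  \<open>k\<close> values, too few for all nonzero elements.\<close>

lemma power_neq_1:
  assumes "0 < k" "k < CARD('a) - 1" shows "g ^ k \<noteq> 1"
proof
  assume 1: "g ^ k = 1"
  have "range (\<lambda>k::nat. g ^ k) \<subseteq> (\<lambda>i. g ^ i) ` {..<k}"
  proof (intro image_subsetI)
    fix n
    have "g ^ n = g ^ (k * (n div k) + n mod k)" by simp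
    also have "\<dots> = g ^ (n mod k)" unfolding power_add power_mult by (simp add: 1)
    finally show "g ^ n \<in> (\<lambda>i. g ^ i) ` {..<k}" using assms(1) by (intro image_eqI[of _ _ "n mod k"]) auto
  qed
  then have "card (- {0::'a}) \<le> card ((\<lambda>i. g ^ i) ` {..<k})"
    unfolding range by (intro card_mono) auto
  also have "\<dots> \<le> k" using card_image_le[of "{..<k}" "\<lambda>i. g ^ i"] by simp
  finally show False using assms(2) by (simp add: Compl_eq_Diff_UNIV card_Diff_singleton)
qed

lemma inj_power: "inj_on (\<lambda>k. g ^ k) {..<CARD('a) - 1}"
proof (rule linorder_inj_onI')
  fix i j assume "i \<in> {..<CARD('a) - 1}" "j \<in> {..<CARD('a) - 1}" "i < j"
  then have "g ^ (j - i) \<noteq> 1" by (intro power_neq_1) auto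
  moreover have "g ^ j = g ^ i * g ^ (j - i)" using \<open>i < j\<close> by (simp flip: power_add)
  ultimately show "g ^ i \<noteq> g ^ j" using nonzero by auto
qed

end

subsection \<open>Twists and the greedy selection\<close>

definition dilate :: "'a::field \<Rightarrow> 'a poly \<Rightarrow> 'a poly" where
  "dilate a p = p \<circ>\<^sub>p [:0, a:]"

lemma coeff_dilate: "poly.coeff (dilate a p) n = a ^ n * poly.coeff p n"
  by (simp add: dilate_def coeff_pcompose_linear)

lemma dilate_add: "dilate a (p + q) = dilate a p + dilate a q"
  by (simp add: dilate_def pcompose_add)

lemma dilate_mult: "dilate a (p * q) = dilate a p * dilate a q"
  by (simp add: dilate_def pcompose_mult)

lemma dilate_smult: "dilate a (Polynomial.smult c p) = Polynomial.smult c (dilate a p)"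
  by (simp add: dilate_def pcompose_smult)

lemma dilate_dilate: "dilate a (dilate b p) = dilate (a * b) p"
  by (rule poly_eqI) (simp add: coeff_dilate power_mult_distrib)

lemma dilate_1: "dilate 1 p = p"
  by (rule poly_eqI) (simp add: coeff_dilate)

lemma dilate_dvd: "p dvd q \<Longrightarrow> dilate a p dvd dilate a q"
  by (auto simp: dilate_mult elim!: dvdE)

lemma degree_dilate: "a \<noteq> 0 \<Longrightarrow> degree (dilate a p) = degree p"
  by (simp add: dilate_def degree_pcompose)

lemma dilate_eq_0_iff: "a \<noteq> 0 \<Longrightarrow> dilate a p = 0 \<longleftrightarrow> p = 0"
  by (metis dilate_1 dilate_dilate dilate_def left_inverse pcompose_0)

text \<open>Dilation by \<open>a\<close> is a degree-preserving ring automorphism with inverse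
  \<open>dilate (inverse a)\<close>.\<close>

lemma irreducible_dilate:
  assumes "a \<noteq> 0" "irreducible p" shows "irreducible (dilate a p)"
proof (rule irreducibleI)
  have p: "p \<noteq> 0" "degree p \<noteq> 0" using assms(2) is_unit_iff_degree by (auto simp: irreducible_def)
  show "dilate a p \<noteq> 0" using p assms(1) by (simp add: dilate_eq_0_iff)
  then show "\<not> dilate a p dvd 1" using p assms(1) by (simp add: is_unit_iff_degree degree_dilate)
  fix u v assume uv: "dilate a p = u * v"
  then have "u \<noteq> 0" "v \<noteq> 0" using \<open>dilate a p \<noteq> 0\<close> by auto
  have "p = dilate (inverse a) u * dilate (inverse a) v"
    using arg_cong[OF uv, of "dilate (inverse a)"] assms(1)
    by (simp add: dilate_dilate dilate_mult dilate_1)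
  then have "dilate (inverse a) u dvd 1 \<or> dilate (inverse a) v dvd 1"
    using assms(2) irreducibleD by blast
  moreover have "dilate (inverse a) w dvd 1 \<longleftrightarrow> w dvd 1" if "w \<noteq> 0" for w
    using that assms(1) by (simp add: is_unit_iff_degree degree_dilate dilate_eq_0_iff)
  ultimately show "u dvd 1 \<or> v dvd 1" using \<open>u \<noteq> 0\<close> \<open>v \<noteq> 0\<close> by blast
qed

lemma twists_eq: "twists g t p = map (\<lambda>j. dilate (g ^ j) p) [0..<t]"
  by (simp add: twists_def dilate_def)

lemma not_coprime_irreducibles:
  fixes p q :: "'a::field poly"
  assumes "irreducible p" "irreducible q" "\<not> coprime p q"
  obtains c where "c \<noteq> 0" "p = Polynomial.smult c q"
proof -
  have "q dvd p"
  proof -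
    obtain d where d: "d dvd p" "d dvd q" "\<not> d dvd 1" using assms(3) by (auto simp: coprime_def)
    then obtain e where e: "q = d * e" by (auto elim: dvdE)
    then have "e dvd 1" using assms(2) d(3) irreducibleD by blast
    then have "q dvd d" unfolding e by (metis dvd_refl mult_dvd_mono mult.right_neutral)
    then show ?thesis using d(1) by (rule dvd_trans)
  qed
  then obtain u where u: "p = q * u" by (auto elim: dvdE)
  then have "u dvd 1" using assms irreducibleD[of p q u] by (auto simp: irreducible_def)
  then obtain c where "u = [:c:]" "c dvd 1" by (rule is_unit_polyE)
  moreover from this(2) have "c \<noteq> 0" by auto
  ultimately show thesis using that[of c] u by simp
qed

lemma irreducible_polys_props:
  assumes "distinct fs" "set fs = (UNIV :: 'a::field set)"
  shows "distinct (irreducible_polys fs r)" "set (irreducible_polys fs r) = monic_irreducibles r"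
proof -
  show "distinct (irreducible_polys fs r)"
    unfolding irreducible_polys_def
    by (intro distinct_filter) (simp add: distinct_map distinct_n_lists assms(1) inj_on_subset[OF inj_Poly_snoc_1])
  show "set (irreducible_polys fs r) = monic_irreducibles r"
    by (auto simp: irreducible_polys_def monic_irreducibles_def monic_polys_eq_image set_n_lists assms(2))
qed

lemma length_irreducible_polys:
  assumes "distinct fs" "set fs = (UNIV :: 'a::field set)"
  shows "length (irreducible_polys fs r) = card (monic_irreducibles r :: 'a poly set)"
  using distinct_card irreducible_polys_props[OF assms] by metis

text \<open>
  A rejected \<open>p\<close> was incompatible with the selection \<open>sel''\<close> at the time it was examined,
  which is only a part of the final one.
\<close>
lemma fold_greedy:
  assumes "Q sel" "sel' = fold (\<lambda>p sel. if Q (p # sel) then p # sel else sel) ps sel"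
  shows "Q sel' \<and> set sel \<subseteq> set sel' \<and> set sel' \<subseteq> set ps \<union> set sel \<and>
    (\<forall>p\<in>set ps. p \<in> set sel' \<or> (\<exists>sel''. set sel'' \<subseteq> set sel' \<and> Q sel'' \<and> \<not> Q (p # sel'')))"
  using assms
proof (induction ps arbitrary: sel)
  case (Cons p ps)
  let ?s = "if Q (p # sel) then p # sel else sel"
  have "Q ?s" using Cons.prems(1) by simp
  moreover have "sel' = fold (\<lambda>p sel. if Q (p # sel) then p # sel else sel) ps ?s"
    using Cons.prems(2) by simp
  ultimately have IH: "Q sel' \<and> set ?s \<subseteq> set sel' \<and> set sel' \<subseteq> set ps \<union> set ?s \<and>
    (\<forall>p\<in>set ps. p \<in> set sel' \<or> (\<exists>sel''. set sel'' \<subseteq> set sel' \<and> Q sel'' \<and> \<not> Q (p # sel'')))"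
    by (rule Cons.IH)
  have "p \<in> set sel' \<or> (\<exists>sel''. set sel'' \<subseteq> set sel' \<and> Q sel'' \<and> \<not> Q (p # sel''))"
    using IH Cons.prems(1) by (cases "Q (p # sel)") auto
  then show ?case using IH by (cases "Q (p # sel)") auto
qed simp

text \<open>The selection at the time of a rejection was itself pairwise coprime. The conflict thus
  lies among the twists of \<open>p\<close>, or between a twist of \<open>p\<close> and one of an
  earlier selected polynomial.\<close>

lemma select_twist_coprime_props:
  fixes g :: "'a::field" and t :: nat and ps :: "'a poly list"
  defines "sel \<equiv> select_twist_coprime g t ps"
  shows "sorted_wrt coprime (concat (map (twists g t) sel))" "set sel \<subseteq> set ps"
    "\<And>p. p \<in> set ps \<Longrightarrow> p \<in> set sel \<or> \<not> sorted_wrt coprime (twists g t p) \<or>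
       (\<exists>q\<in>set sel. \<exists>f\<in>set (twists g t p). \<exists>h\<in>set (twists g t q). \<not> coprime f h)"
proof -
  let ?Q = "\<lambda>qs. sorted_wrt coprime (concat (map (twists g t) qs))"
  have greedy: "?Q sel \<and> set [] \<subseteq> set sel \<and> set sel \<subseteq> set ps \<union> set [] \<and>
    (\<forall>p\<in>set ps. p \<in> set sel \<or> (\<exists>sel''. set sel'' \<subseteq> set sel \<and> ?Q sel'' \<and> \<not> ?Q (p # sel'')))"
    by (rule fold_greedy) (simp_all add: sel_def select_twist_coprime_def)
  then show "?Q sel" "set sel \<subseteq> set ps" by auto
  fix p assume "p \<in> set ps"
  then show "p \<in> set sel \<or> \<not> sorted_wrt coprime (twists g t p) \<or>
       (\<exists>q\<in>set sel. \<exists>f\<in>set (twists g t p). \<exists>h\<in>set (twists g t q). \<not> coprime f h)"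
    using greedy by (fastforce simp: sorted_wrt_append)
qed

lemma sorted_wrt_concat_map:
  assumes "sorted_wrt P (concat (map f xs))"
  shows "sorted_wrt (\<lambda>a b. \<forall>x\<in>set (f a). \<forall>y\<in>set (f b). P x y) xs \<and> (\<forall>a\<in>set xs. sorted_wrt P (f a))"
  using assms by (induction xs) (auto simp: sorted_wrt_append)

text \<open>For \<open>k dvd r\<close> these are the polynomials \<open>h(X ^ (r / k))\<close> with \<open>h\<close> monic of degree \<open>k\<close>.\<close>
definition lacunary :: "nat \<Rightarrow> nat \<Rightarrow> 'a::field poly set" where
  "lacunary r k = {p \<in> monic_polys r. \<forall>n. poly.coeff p n \<noteq> 0 \<longrightarrow> (r div k) dvd n}"

text \<open>With \<open>e = r div k\<close>, the coefficients at
  \<open>0, e, ..., e * (k - 1)\<close> determine \<open>p\<close>: the one at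
  \<open>e * k = r\<close> is 1, and the others vanish.\<close>

lemma card_lacunary_le:
  assumes "k dvd r" "0 < r" shows "card (lacunary r k :: 'a::{finite,field} poly set) \<le> CARD('a) ^ k"
proof -
  define e where "e = r div k"
  have r: "r = e * k" using assms by (simp add: e_def)
  have "e > 0" using r assms by (cases e) auto
  let ?c = "\<lambda>p :: 'a poly. map (\<lambda>i. poly.coeff p (e * i)) [0..<k]"
  have "inj_on ?c (lacunary r k)"
  proof (rule inj_onI, rule poly_eqI)
    fix p q n assume p: "p \<in> lacunary r k" and q: "q \<in> lacunary r k" and eq: "?c p = ?c q"
    show "poly.coeff p n = poly.coeff q n"
    proof (cases "e dvd n")
      case True
      then obtain i where i: "n = e * i" by (auto elim: dvdE)
      consider "i < k" | "i = k" | "i > k" by linarith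
      then show ?thesis
      proof cases
        case 1 then show ?thesis using eq i by (auto simp: map_eq_conv)
      next
        case 2 then show ?thesis using p q i r by (auto simp: lacunary_def monic_polys_def)
      next
        case 3
        then have "n > r" using i r \<open>e > 0\<close> by simp
        then show ?thesis using p q by (auto simp: lacunary_def monic_polys_def coeff_eq_0)
      qed
    next
      case False
      then have "poly.coeff p n = 0" "poly.coeff q n = 0"
        using p q unfolding lacunary_def e_def by blast+
      then show ?thesis by simp
    qed
  qed
  moreover have "?c ` lacunary r k \<subseteq> {xs. set xs \<subseteq> UNIV \<and> length xs = k}" by auto
  ultimately have "card (lacunary r k :: 'a poly set) \<le> card {xs. set xs \<subseteq> (UNIV :: 'a set) \<and> length xs = k}"
    by (rule card_inj_on_le) (rule finite_lists_length_eq, simp)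
  then show ?thesis using card_lists_length_eq[of "UNIV :: 'a set" k] by simp
qed

text \<open>If the constant coefficient vanishes, irreducibility forces \<open>p = X\<close>.
  Otherwise comparing constant coefficients gives \<open>c = 1\<close>, so \<open>a ^ n = 1\<close>
  for every \<open>n\<close> in the support of \<open>p\<close>, and the order of \<open>a\<close>
  divides all these exponents.\<close>

lemma dilate_associated_imp_lacunary:
  fixes p :: "'a::{finite,field} poly"
  assumes p: "p \<in> monic_irreducibles r" and a: "a \<noteq> 0" "a \<noteq> 1"
    and c: "p = Polynomial.smult c (dilate a p)"
  shows "p = [:0, 1:] \<and> r = 1 \<or> (\<exists>k\<in>{1..r div 2}. k dvd r \<and> p \<in> lacunary r k)"
proof (cases "poly.coeff p 0 = 0")
  case True
  have m: "[:0, 1:] \<in> (monic_irreducibles 1 :: 'a poly set)"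
    using irreducible_linear_field_poly[of "1::'a" 0] by (simp add: monic_irreducibles_def monic_polys_def)
  have "[:0, 1:] dvd p" using True dvd_iff_poly_eq_0[of 0 p] by (simp add: poly_0_coeff_0)
  then have "p = [:0, 1:]" using monic_irreducibles_dvd_imp_eq[OF m p] by simp
  then show ?thesis using monic_irreducibles_degree(1)[OF p] by simp
next
  case False
  have cf: "poly.coeff p n = c * (a ^ n * poly.coeff p n)" for n
    using arg_cong[OF c, of "\<lambda>p. poly.coeff p n"] by (simp add: coeff_dilate)
  have "c = 1" using cf[of 0] False by simp
  then have a1: "a ^ n = 1" if "poly.coeff p n \<noteq> 0" for n using cf[of n] that by simp
  have pr: "p \<in> monic_polys r" using p by (simp add: monic_irreducibles_def)
  have r: "r > 0" using monic_irreducibles_degree[OF p] by simp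
  have ar: "a ^ r = 1" using a1[of r] pr by (auto simp: monic_polys_def)
  \<comment> \<open>The multiplicative order of \<open>a\<close>; it is at least 2 because
    \<open>a \<noteq> 1\<close>.\<close>
  define e where "e = (LEAST e. e > 0 \<and> a ^ e = 1)"
  have e: "e > 0" "a ^ e = 1" using LeastI[of "\<lambda>e. e > 0 \<and> a ^ e = 1" r] r ar by (auto simp: e_def)
  have dvd: "e dvd n" if "a ^ n = 1" for n
  proof -
    have "a ^ (n mod e) = 1"
    proof -
      have "a ^ n = a ^ (e * (n div e) + n mod e)" by simp
      also have "\<dots> = a ^ (n mod e)" unfolding power_add power_mult by (simp add: e)
      finally show ?thesis using that by simp
    qed
    moreover have "n mod e < e" using e(1) by simp
    ultimately have "n mod e = 0"
      using not_less_Least[of "n mod e" "\<lambda>e. e > 0 \<and> a ^ e = 1"] unfolding e_def[symmetric] by auto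
    then show ?thesis by (simp add: dvd_eq_mod_eq_0)
  qed
  have "e \<noteq> 1" using e a by auto
  then have e2: "e \<ge> 2" using e by simp
  obtain k where k: "r = e * k" using dvd[OF ar] by (auto elim: dvdE)
  then have "k > 0" using r by (cases k) auto
  have "2 * k \<le> r" unfolding k using e2 by (rule mult_right_mono) simp
  then have "k \<in> {1..r div 2}" using \<open>k > 0\<close> by auto
  moreover have "k dvd r" using k by simp
  moreover have "r div k = e" using k \<open>k > 0\<close> by simp
  then have "p \<in> lacunary r k" using pr a1 dvd by (auto simp: lacunary_def)
  ultimately show ?thesis by blast
qed

section \<open>Counting the polynomials lost in the selection\<close>

context primitive
begin

text \<open>A conflict makes twist \<open>i\<close> of \<open>p\<close> a scalar multiple of twist
  \<open>j\<close> of \<open>q\<close>. Undoing the twist, \<open>p\<close> is the monic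
  normalization of the dilate of \<open>q\<close> by \<open>g powi (j - i)\<close>; the exponent can
  be negative and lies in an interval of \<open>2 * t\<close> integers.\<close>

lemma card_conflicting_le:
  assumes "q \<in> monic_irreducibles r"
  shows "card {p \<in> monic_irreducibles r. \<exists>f\<in>set (twists g t p). \<exists>h\<in>set (twists g t q). \<not> coprime f h} \<le> 2 * t"
proof -
  let ?N = "{p \<in> monic_irreducibles r. \<exists>f\<in>set (twists g t p). \<exists>h\<in>set (twists g t q). \<not> coprime f h}"
  let ?n = "\<lambda>k. Polynomial.smult (inverse (lead_coeff (dilate (g powi k) q))) (dilate (g powi k) q)"
  have q: "irreducible q" using assms by (simp add: monic_irreducibles_def)
  have "?N \<subseteq> ?n ` {-int t..<int t}"
  proof
    fix p assume p: "p \<in> ?N"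
    then have pi: "irreducible p" and pl: "lead_coeff p = 1" by (auto simp: monic_irreducibles_def monic_polys_def)
    obtain i j where ij: "i < t" "j < t" and nc: "\<not> coprime (dilate (g ^ i) p) (dilate (g ^ j) q)"
      using p by (auto simp: twists_eq)
    obtain c where c: "c \<noteq> 0" "dilate (g ^ i) p = Polynomial.smult c (dilate (g ^ j) q)"
      by (rule not_coprime_irreducibles[OF _ _ nc]) (simp_all add: irreducible_dilate pi q nonzero)
    have "p = dilate (inverse (g ^ i)) (dilate (g ^ i) p)"
      by (simp add: dilate_dilate dilate_1 nonzero)
    also have "\<dots> = Polynomial.smult c (dilate (inverse (g ^ i) * g ^ j) q)"
      unfolding c(2) by (simp add: dilate_smult dilate_dilate)
    also have "inverse (g ^ i) * g ^ j = g powi (int j - int i)"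
      using nonzero by (simp add: power_int_diff field_simps)
    finally have pc: "p = Polynomial.smult c (dilate (g powi (int j - int i)) q)" .
    then have "1 = c * lead_coeff (dilate (g powi (int j - int i)) q)"
      using pl lead_coeff_smult[of c "dilate (g powi (int j - int i)) q"] by metis
    then have "c = inverse (lead_coeff (dilate (g powi (int j - int i)) q))"
      by (metis inverse_inverse_eq inverse_unique mult.commute)
    then have "p = ?n (int j - int i)" using pc by simp
    then show "p \<in> ?n ` {-int t..<int t}" using ij by (intro image_eqI[of _ _ "int j - int i"]) auto
  qed
  then have "card ?N \<le> card (?n ` {-int t..<int t})" by (intro card_mono) auto
  also have "\<dots> \<le> card {-int t..<int t}" by (rule card_image_le) simp
  finally show ?thesis by simp
qed

lemma card_not_self_coprime_le:
  assumes "t < CARD('a)" "r > 0"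
  shows "card {p \<in> monic_irreducibles r. \<not> sorted_wrt coprime (twists g t p)}
           \<le> (if r = 1 then 1 else 0) + (\<Sum>k=1..r div 2. CARD('a) ^ k)"
proof -
  let ?X = "if r = 1 then {[:0, 1:]} else ({} :: 'a poly set)"
  let ?K = "{k \<in> {1..r div 2}. k dvd r}"
  have fin: "finite (lacunary r k :: 'a poly set)" for k
    by (rule finite_subset[OF _ finite_monic_polys[of r]]) (auto simp: lacunary_def)
  have "{p \<in> monic_irreducibles r. \<not> sorted_wrt coprime (twists g t p)} \<subseteq> ?X \<union> (\<Union>k\<in>?K. lacunary r k :: 'a poly set)"
  proof
    fix p assume "p \<in> {p \<in> monic_irreducibles r. \<not> sorted_wrt coprime (twists g t p)}"
    then have p: "p \<in> monic_irreducibles r" and ns: "\<not> sorted_wrt coprime (twists g t p)" by auto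
    have pi: "irreducible p" using p by (simp add: monic_irreducibles_def)
    obtain i j where ij: "i < j" "j < t" and nc: "\<not> coprime (dilate (g ^ i) p) (dilate (g ^ j) p)"
      using ns by (auto simp: sorted_wrt_iff_nth_less twists_eq)
    obtain c where c: "c \<noteq> 0" "dilate (g ^ i) p = Polynomial.smult c (dilate (g ^ j) p)"
      by (rule not_coprime_irreducibles[OF _ _ nc]) (simp_all add: irreducible_dilate pi nonzero)
    have "p = dilate (inverse (g ^ i)) (dilate (g ^ i) p)"
      by (simp add: dilate_dilate dilate_1 nonzero)
    also have "\<dots> = Polynomial.smult c (dilate (inverse (g ^ i) * g ^ j) p)"
      unfolding c(2) by (simp add: dilate_smult dilate_dilate)
    also have "inverse (g ^ i) * g ^ j = g ^ (j - i)"
      using nonzero ij by (simp add: power_diff field_simps)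
    finally have "p = Polynomial.smult c (dilate (g ^ (j - i)) p)" .
    \<comment> \<open>Here \<open>0 < j - i < t \<le> CARD('a) - 1\<close>.\<close>
    moreover have "g ^ (j - i) \<noteq> 1" using ij assms(1) by (intro power_neq_1) auto
    ultimately have "p = [:0, 1:] \<and> r = 1 \<or> (\<exists>k\<in>{1..r div 2}. k dvd r \<and> p \<in> lacunary r k)"
      using p nonzero by (intro dilate_associated_imp_lacunary) auto
    then show "p \<in> ?X \<union> (\<Union>k\<in>?K. lacunary r k :: 'a poly set)" by auto
  qed
  then have "card {p \<in> monic_irreducibles r. \<not> sorted_wrt coprime (twists g t p)}
      \<le> card (?X \<union> (\<Union>k\<in>?K. lacunary r k :: 'a poly set))"
    by (intro card_mono) (auto intro: fin)
  also have "\<dots> \<le> card ?X + card (\<Union>k\<in>?K. lacunary r k :: 'a poly set)" by (rule card_Un_le)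
  also have "card (\<Union>k\<in>?K. lacunary r k :: 'a poly set) \<le> (\<Sum>k\<in>?K. card (lacunary r k :: 'a poly set))" by (rule card_UN_le) simp
  also have "\<dots> \<le> (\<Sum>k\<in>?K. CARD('a) ^ k)" using assms(2) by (intro sum_mono card_lacunary_le) auto
  also have "\<dots> \<le> (\<Sum>k=1..r div 2. CARD('a) ^ k)" by (intro sum_mono2) auto
  finally show ?thesis by (simp split: if_splits)
qed

text \<open>Every irreducible has dependent twists of its own or conflicts with a selected
  polynomial. The selected ones are covered too, since each conflicts with itself.\<close>

lemma card_monic_irreducibles_le_select:
  assumes fs: "distinct fs" "set fs = UNIV" and t: "0 < t" "t < CARD('a)" and r: "r > 0"
  shows "card (monic_irreducibles r :: 'a poly set)
    \<le> length (select_twist_coprime g t (irreducible_polys fs r)) * (2 * t)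
       + (if r = 1 then 1 else 0) + (\<Sum>k=1..r div 2. CARD('a) ^ k)"
proof -
  let ?sel = "select_twist_coprime g t (irreducible_polys fs r)"
  let ?N = "\<lambda>q. {p \<in> monic_irreducibles r. \<exists>f\<in>set (twists g t p). \<exists>h\<in>set (twists g t q). \<not> coprime f h}"
  let ?B = "{p \<in> monic_irreducibles r. \<not> sorted_wrt coprime (twists g t p)}"
  note props = select_twist_coprime_props[where g = g and t = t and ps = "irreducible_polys fs r"]
  note set = irreducible_polys_props(2)[OF fs, of r]
  have finN: "finite (?N q)" for q by (rule finite_subset[OF _ finite_monic_irreducibles[of r]]) auto
  have "monic_irreducibles r \<subseteq> (\<Union>q\<in>set ?sel. ?N q) \<union> ?B"
  proof
    fix p :: "'a poly" assume p: "p \<in> monic_irreducibles r"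
    have "p \<in> ?N p"
    proof -
      have "\<not> coprime p p" using p by (auto simp: monic_irreducibles_def irreducible_def)
      moreover have "p \<in> set (twists g t p)"
        using t dilate_1[of p] by (force simp: twists_eq intro!: image_eqI[of _ _ 0])
      ultimately show ?thesis using p by blast
    qed
    then show "p \<in> (\<Union>q\<in>set ?sel. ?N q) \<union> ?B" using props(3)[of p] p set by auto
  qed
  then have "card (monic_irreducibles r :: 'a poly set) \<le> card ((\<Union>q\<in>set ?sel. ?N q) \<union> ?B)"
    using finite_monic_irreducibles[of r, where 'a='a] by (intro card_mono) (auto intro: finN)
  also have "\<dots> \<le> card (\<Union>q\<in>set ?sel. ?N q) + card ?B" by (rule card_Un_le)
  also have "card (\<Union>q\<in>set ?sel. ?N q) \<le> (\<Sum>q\<in>set ?sel. card (?N q))" by (rule card_UN_le) simp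
  also have "\<dots> \<le> (\<Sum>q\<in>set ?sel. 2 * t)"
    using props(2) set by (intro sum_mono card_conflicting_le) auto
  also have "\<dots> \<le> length ?sel * (2 * t)" by (simp add: card_length)
  also have "card ?B \<le> (if r = 1 then 1 else 0) + (\<Sum>k=1..r div 2. CARD('a) ^ k)"
    by (rule card_not_self_coprime_le[OF t(2) r])
  finally show ?thesis by simp
qed

end

subsection \<open>The two design bounds\<close>

text \<open>Since \<open>p i\<close> does not divide the product over the other indices, its power
  has to divide the cofactor of that product in \<open>x\<close>.\<close>

lemma prod_prime_powers_dvd:
  fixes p :: "'i \<Rightarrow> 'b::algebraic_semidom"
  assumes "finite I" "\<And>i. i \<in> I \<Longrightarrow> prime_elem (p i)"
    "\<And>i j. i \<in> I \<Longrightarrow> j \<in> I \<Longrightarrow> i \<noteq> j \<Longrightarrow> \<not> p i dvd p j"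
    "\<And>i. i \<in> I \<Longrightarrow> p i ^ n i dvd x"
  shows "(\<Prod>i\<in>I. p i ^ n i) dvd x"
  using assms
proof (induction I rule: finite_induct)
  case (insert i I)
  let ?P = "\<Prod>i\<in>I. p i ^ n i"
  have "?P dvd x" using insert.IH insert.prems by simp
  then obtain y where y: "x = ?P * y" by (auto elim: dvdE)
  have pi: "prime_elem (p i)" using insert.prems by simp
  have nd: "\<not> p i dvd ?P"
  proof
    assume "p i dvd ?P"
    with insert.hyps(1) have "\<exists>j\<in>I. p i dvd p j ^ n j"
    proof (induction I rule: finite_induct)
      case empty then show ?case using prime_elem_not_unit[OF pi] by simp
    next
      case (insert j J) then show ?case using prime_elem_dvd_multD[OF pi] by fastforce
    qed
    then obtain j where "j \<in> I" "p i dvd p j ^ n j" by blast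
    then have "p i dvd p j" using prime_elem_dvd_power[OF pi] by blast
    then show False using insert.prems(2)[of i j] insert.hyps(2) \<open>j \<in> I\<close> by auto
  qed
  have "p i ^ n i dvd y"
  proof (cases "n i = 0")
    case False
    moreover have "p i ^ n i dvd ?P * y" using insert.prems(3)[of i] y by simp
    ultimately show ?thesis using prime_power_dvd_multD[OF pi, of "n i" ?P y] nd by simp
  qed simp
  then have "?P * p i ^ n i dvd ?P * y" by (rule mult_dvd_mono[OF dvd_refl])
  then show ?case using insert.hyps y by (simp add: mult.commute)
qed simp

lemma coprime_primes_not_dvd:
  assumes "prime_elem p" "coprime p q" shows "\<not> p dvd q"
  using assms coprime_common_divisor[of p q p] prime_elem_not_unit by auto

lemma sum_prime_powers_degree_le:
  fixes p :: "'i \<Rightarrow> 'a::field poly"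
  assumes "finite I" "\<And>i. i \<in> I \<Longrightarrow> prime_elem (p i) \<and> degree (p i) = r"
    "\<And>i j. i \<in> I \<Longrightarrow> j \<in> I \<Longrightarrow> i \<noteq> j \<Longrightarrow> \<not> p i dvd p j"
    "\<And>i. i \<in> I \<Longrightarrow> p i ^ n i dvd x" and "x \<noteq> 0"
  shows "r * (\<Sum>i\<in>I. n i) \<le> degree x"
proof -
  have "(\<Prod>i\<in>I. p i ^ n i) dvd x" using assms by (intro prod_prime_powers_dvd) auto
  then have le: "degree (\<Prod>i\<in>I. p i ^ n i) \<le> degree x" using assms(5) by (rule dvd_imp_degree_le)
  have nz: "p i \<noteq> 0" if "i \<in> I" for i using assms(2)[OF that] by auto
  then have "degree (\<Prod>i\<in>I. p i ^ n i) = (\<Sum>i\<in>I. degree (p i ^ n i))"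
    by (intro degree_prod_eq_sum_degree) simp
  also have "\<dots> = (\<Sum>i\<in>I. r * n i)"
    using assms(2) nz by (intro sum.cong) (auto simp: degree_power_eq)
  finally show ?thesis using le by (simp add: sum_distrib_left)
qed

text \<open>Each derivative costs at most one factor \<open>p\<close>. For \<open>j \<ge> t\<close>
  the truncated exponent is 0 and the claim is trivial.\<close>

lemma power_dvd_higher_pderiv:
  fixes p f :: "'a::field poly"
  assumes "p ^ t dvd f" shows "p ^ (t - j) dvd (pderiv ^^ j) f"
proof (induction j)
  case 0 then show ?case using assms by simp
next
  case (Suc j)
  show ?case
  proof (cases "t - j")
    case 0
    then have "t - Suc j = 0" by simp
    then show ?thesis by (metis one_dvd power_0)
  next
    case (Suc k)
    then obtain u where u: "(pderiv ^^ j) f = p ^ Suc k * u" using Suc.IH by (auto elim: dvdE)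
    have "p ^ k dvd pderiv (p ^ Suc k * u)"
      unfolding pderiv_mult pderiv_power_Suc by (simp add: dvd_smult)
    moreover have "t - Suc j = k" using Suc by simp
    ultimately show ?thesis by (simp add: u del: power_Suc)
  qed
qed

text \<open>\<open>X ^ j\<close> times the \<open>j\<close>-th derivative multiplies the coefficient
  of \<open>X ^ n\<close> by the falling factorial \<open>n * (n - 1) * ... * (n - j + 1)\<close>, a
  monic polynomial of degree \<open>j\<close> in \<open>n\<close>. The points
  \<open>0, ..., m - 1\<close> stay distinct in the field because \<open>m\<close> is below the
  characteristic.\<close>

lemma wronskian_operators_pderiv:
  assumes cs: "distinct cs" "set cs = (UNIV :: 'm::finite set)" and m: "CARD('m) < CHAR('a::field)"
  shows "wronskian_operators cs (\<lambda>j. pderiv ^^ j :: 'a poly \<Rightarrow> 'a poly) (\<lambda>j. j)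
           (\<lambda>j. \<Prod>k<j. [:- of_nat k, 1:]) of_nat"
proof unfold_locales
  fix j :: nat and f :: "'a poly"
  have dp: "degree (\<Prod>k<j. [:- of_nat k, 1 :: 'a:]) = j"
    by (subst degree_prod_eq_sum_degree) simp_all
  moreover have "lead_coeff (\<Prod>k<j. [:- of_nat k, 1 :: 'a:]) = 1"
    by (simp add: lead_coeff_prod)
  ultimately show "degree (\<Prod>k<j. [:- of_nat k, 1 :: 'a:]) = j \<and> lead_coeff (\<Prod>k<j. [:- of_nat k, 1 :: 'a:]) = 1"
    by simp
  have coeff: "poly.coeff (Polynomial.monom 1 j * (pderiv ^^ j) f) n =
      (if n < j then 0 else pochhammer (of_nat (Suc (n - j))) j * poly.coeff f n)" for n
    by (simp add: coeff_monom_mult coeff_higher_pderiv)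
  show "degree (Polynomial.monom 1 j * (pderiv ^^ j) f) \<le> degree f"
    by (rule degree_le) (simp add: coeff coeff_eq_0)
  have "poly (\<Prod>k<j. [:- of_nat k, 1:]) (of_nat d :: 'a) = (if d < j then 0 else pochhammer (of_nat (Suc (d - j))) j)" for d
  proof (cases "d < j")
    case True then show ?thesis by (auto simp: poly_prod intro!: prod_zero)
  next
    case False
    have "poly (\<Prod>k<j. [:- of_nat k, 1:]) (of_nat d :: 'a) = (\<Prod>k<j. of_nat (d - k))"
      using False by (auto simp: poly_prod of_nat_diff intro!: prod.cong)
    also have "\<dots> = (\<Prod>k<j. of_nat (Suc (d - j) + k))"
      using False by (subst prod.nat_diff_reindex[symmetric]) (auto intro!: prod.cong arg_cong[of _ _ of_nat])
    also have "\<dots> = pochhammer (of_nat (Suc (d - j))) j"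
      by (simp add: pochhammer_prod lessThan_atLeast0 add.assoc)
    finally show ?thesis using False by simp
  qed
  then show "poly.coeff (Polynomial.monom 1 j * (pderiv ^^ j) f) (degree f)
      = lead_coeff f * poly (\<Prod>k<j. [:- of_nat k, 1:]) (of_nat (degree f))"
    by (simp add: coeff mult.commute)
next
  show "inj_on (of_nat :: nat \<Rightarrow> 'a) {..<CARD('m)}"
  proof (rule linorder_inj_onI')
    fix i k assume "i \<in> {..<CARD('m)}" "k \<in> {..<CARD('m)}" "i < k"
    then have "\<not> CHAR('a) dvd (k - i)" using m by (auto dest: dvd_imp_le)
    then have "(of_nat (k - i) :: 'a) \<noteq> 0" by (simp add: of_nat_eq_0_iff_char_dvd)
    then show "(of_nat i :: 'a) \<noteq> of_nat k" using \<open>i < k\<close> by (auto simp: of_nat_diff)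
  qed
qed (simp_all add: cs higher_pderiv_add higher_pderiv_smult)

text \<open>Dilation by \<open>g ^ j\<close> multiplies the coefficient of \<open>X ^ n\<close> by
  \<open>(g ^ n) ^ j\<close>, so the matrix is an ordinary Vandermonde matrix at powers of
  \<open>g\<close>. Degrees do not drop, hence \<open>b = 0\<close>.\<close>

lemma (in primitive) wronskian_operators_dilate:
  assumes cs: "distinct cs" "set cs = (UNIV :: 'm::finite set)" and m: "CARD('m) < CARD('a)"
  shows "wronskian_operators cs (\<lambda>j. dilate (g ^ j)) (\<lambda>j. 0) (Polynomial.monom 1) (\<lambda>d. g ^ d)"
proof unfold_locales
  show "inj_on (\<lambda>d. g ^ d) {..<CARD('m)}"
    by (rule inj_on_subset[OF inj_power]) (use m in auto)
  fix j :: nat and f :: "'a poly"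
  show "poly.coeff (Polynomial.monom 1 0 * dilate (g ^ j) f) (degree f)
      = lead_coeff f * poly (Polynomial.monom 1 j) (g ^ degree f)"
    by (simp add: monom_0 coeff_dilate poly_monom mult.commute flip: power_mult)
qed (simp_all add: cs dilate_add dilate_smult degree_monom_eq monom_0 degree_dilate nonzero)

lemma sum_lessThan_real: "(\<Sum>j<s. real j) = real s * (real s - 1) / 2"
  by (induction s) (simp_all add: field_simps)

lemma sum_descending_real:
  assumes "s \<le> m"
  shows "(\<Sum>i<s. real (m - 1 - i)) = (real m - 1 - (real s - 1) / 2) * real s"
proof -
  have "(\<Sum>i<s. real (m - 1 - i)) = (\<Sum>i<s. (real m - 1) - real i)"
    using assms by (intro sum.cong) auto
  also have "\<dots> = real s * (real m - 1) - real s * (real s - 1) / 2"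
    by (simp add: sum_subtractf sum_lessThan_real)
  finally show ?thesis by (simp add: field_simps)
qed

text \<open>The Wronskian uses derivatives of order \<open>j \<le> s - 1\<close>, each still
  divisible by \<open>p ^ (t - s + 1)\<close>. The degrees lost by differentiation give the extra
  sum of the \<open>j\<close>, which is the gain over the folded bound.\<close>

lemma mult_design_bound:
  fixes W :: "('a::field ^ 'm::finite) set"
  assumes cs: "distinct cs" "set cs = UNIV" and m: "CARD('m) < CHAR('a)"
    and ps: "distinct ps" "set ps \<subseteq> monic_irreducibles r"
    and W: "vec.subspace W" "vec.dim W = s" and s: "s \<le> t"
  shows "r * (t - s + 1) * (\<Sum>i<length ps. vec.dim (mult_subspace cs t (ps ! i) \<inter> W)) + (\<Sum>j<s. j)
           \<le> (\<Sum>i<s. CARD('m) - 1 - i)"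
proof -
  interpret wronskian_operators cs "\<lambda>j. pderiv ^^ j :: 'a poly \<Rightarrow> 'a poly" "\<lambda>j. j"
      "\<lambda>j. \<Prod>k<j. [:- of_nat k, 1:]" of_nat
    by (rule wronskian_operators_pderiv[OF cs m])
  obtain \<Omega> where \<Omega>: "\<Omega> \<noteq> 0" "degree \<Omega> + (\<Sum>j<s. j) \<le> (\<Sum>i<s. CARD('m) - 1 - i)"
    and dvd: "\<And>H D. vec.subspace H \<Longrightarrow> (\<And>v j. v \<in> H \<Longrightarrow> j < s \<Longrightarrow> D dvd (pderiv ^^ j) (vec_poly cs v)) \<Longrightarrow>
       D ^ vec.dim (H \<inter> W) dvd \<Omega>"
    using obtain_subspace_wronskian[OF W] by blast
  let ?d = "\<lambda>i. vec.dim (mult_subspace cs t (ps ! i) \<inter> W)"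
  have psi: "ps ! i \<in> monic_irreducibles r" if "i < length ps" for i using that ps(2) nth_mem by blast
  have "r * (\<Sum>i<length ps. (t - s + 1) * ?d i) \<le> degree \<Omega>"
  proof (rule sum_prime_powers_degree_le[of _ "\<lambda>i. ps ! i"])
    fix i assume "i \<in> {..<length ps}"
    then have i: "i < length ps" by simp
    then show "prime_elem (ps ! i) \<and> degree (ps ! i) = r"
      using monic_irreducibles_degree[OF psi] by blast
    have "(ps ! i ^ (t - s + 1)) ^ ?d i dvd \<Omega>"
    proof (rule dvd)
      show "vec.subspace (mult_subspace cs t (ps ! i))"
        using subspace_multiples[of "(ps ! i) ^ t"] by (simp add: mult_subspace_def multiples_def)
      fix v j assume "v \<in> mult_subspace cs t (ps ! i)" and j: "j < s"
      then have "ps ! i ^ t dvd vec_poly cs v" by (simp add: mult_subspace_def)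
      then have "ps ! i ^ (t - j) dvd (pderiv ^^ j) (vec_poly cs v)" by (rule power_dvd_higher_pderiv)
      moreover have "ps ! i ^ (t - s + 1) dvd ps ! i ^ (t - j)" using j s by (intro le_imp_power_dvd) auto
      ultimately show "ps ! i ^ (t - s + 1) dvd (pderiv ^^ j) (vec_poly cs v)" by (rule dvd_trans[rotated])
    qed
    then show "ps ! i ^ ((t - s + 1) * ?d i) dvd \<Omega>" by (simp only: power_mult)
    fix k assume "k \<in> {..<length ps}" "i \<noteq> k"
    then show "\<not> ps ! i dvd ps ! k"
      using monic_irreducibles_dvd_imp_eq[OF psi psi] i ps(1) by (auto simp: nth_eq_iff_index_eq)
  qed (simp_all add: \<Omega>)
  then have "r * (t - s + 1) * (\<Sum>i<length ps. ?d i) \<le> degree \<Omega>"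
    by (simp only: sum_distrib_left[symmetric] mult.assoc)
  then show ?thesis using \<Omega>(2) by linarith
qed

text \<open>The twists are pairwise coprime primes, so divisibility by all of them is divisibility
  by their product, of degree \<open>r * t\<close>.\<close>

lemma (in primitive) folded_subspace_eq_multiples:
  assumes "sorted_wrt coprime (twists g t p)" "p \<in> monic_irreducibles r"
  shows "\<exists>D. D \<noteq> 0 \<and> degree D = r * t \<and> folded_subspace cs g t p = {v. D dvd vec_poly cs v}"
proof -
  let ?f = "\<lambda>j. dilate (g ^ j) p"
  let ?D = "\<Prod>j<t. ?f j"
  have p: "irreducible p" "degree p = r" "p \<noteq> 0"
    using assms(2) monic_irreducibles_degree[OF assms(2)] by (auto simp: monic_irreducibles_def)
  have prime: "prime_elem (?f j)" for j
    using p by (intro field_poly_irreducible_imp_prime irreducible_dilate) (simp_all add: nonzero)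
  have cop: "coprime (?f i) (?f j)" if "i < t" "j < t" "i \<noteq> j" for i j
  proof -
    have lt: "coprime (?f a) (?f b)" if "a < b" "b < t" for a b
      using assms(1) that by (simp add: sorted_wrt_iff_nth_less twists_eq)
    show ?thesis using lt[of i j] lt[of j i] that by (cases "i < j") (simp_all add: coprime_commute)
  qed
  have nz: "?f j \<noteq> 0" for j using p(3) by (simp add: dilate_eq_0_iff nonzero)
  have "?D dvd x \<longleftrightarrow> (\<forall>f\<in>set (twists g t p). f dvd x)" for x
  proof
    assume "\<forall>f\<in>set (twists g t p). f dvd x"
    then have dvd: "\<And>j. j < t \<Longrightarrow> ?f j dvd x" by (auto simp: twists_eq)
    have "(\<Prod>j<t. ?f j ^ 1) dvd x"
    proof (rule prod_prime_powers_dvd)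
      fix i j assume "i \<in> {..<t}" "j \<in> {..<t}" "i \<noteq> j"
      then show "\<not> ?f i dvd ?f j" using coprime_primes_not_dvd[OF prime cop] by simp
    qed (simp_all add: prime dvd)
    then show "?D dvd x" by simp
  next
    assume "?D dvd x"
    moreover have "?f j dvd ?D" if "j < t" for j using that by (intro dvd_prodI) auto
    ultimately have "?f j dvd x" if "j < t" for j using that dvd_trans by blast
    then show "\<forall>f\<in>set (twists g t p). f dvd x" by (auto simp: twists_eq)
  qed
  moreover have "degree ?D = r * t"
    using nz by (subst degree_prod_eq_sum_degree) (simp_all add: degree_dilate nonzero p)
  moreover have "?D \<noteq> 0" using nz by simp
  ultimately show ?thesis by (intro exI[of _ ?D]) (simp add: folded_subspace_def)
qed

lemma (in primitive) folded_design_bound: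
  fixes W :: "('a ^ 'm::finite) set"
  assumes cs: "distinct cs" "set cs = UNIV" and m: "CARD('m) < CARD('a)"
    and cop: "sorted_wrt coprime (concat (map (twists g t) ps))" "set ps \<subseteq> monic_irreducibles r"
    and W: "vec.subspace W" "vec.dim W = s" and s: "0 < s" "s \<le> t"
  shows "r * (t - s + 1) * (\<Sum>i<length ps. vec.dim (folded_subspace cs g t (ps ! i) \<inter> W))
           \<le> (\<Sum>i<s. CARD('m) - 1 - i)"
proof -
  interpret wronskian_operators cs "\<lambda>j. dilate (g ^ j)" "\<lambda>j. 0" "Polynomial.monom 1" "\<lambda>d. g ^ d"
    by (rule wronskian_operators_dilate[OF cs m])
  obtain \<Omega> where \<Omega>: "\<Omega> \<noteq> 0" "degree \<Omega> \<le> (\<Sum>i<s. CARD('m) - 1 - i)"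
    and dvd: "\<And>H D. vec.subspace H \<Longrightarrow> (\<And>v j. v \<in> H \<Longrightarrow> j < s \<Longrightarrow> D dvd dilate (g ^ j) (vec_poly cs v)) \<Longrightarrow>
       D ^ vec.dim (H \<inter> W) dvd \<Omega>"
    using obtain_subspace_wronskian[OF W, unfolded sum.neutral_const add_0_right] by blast
  let ?d = "\<lambda>i. vec.dim (folded_subspace cs g t (ps ! i) \<inter> W)"
  \<comment> \<open>For \<open>k\<close> in \<open>{s - 1..<t}\<close> and every
    \<open>j < s\<close>, the twist with index \<open>k - j\<close> divides the polynomials of the
    subspace; dilating by \<open>g ^ j\<close> makes twist \<open>k\<close> divide all entries of
    their rows.\<close>
  let ?I = "{..<length ps} \<times> {s - 1..<t}"
  let ?p = "\<lambda>(i, k). dilate (g ^ k) (ps ! i)"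
  have psi: "ps ! i \<in> monic_irreducibles r" if "i < length ps" for i using that cop(2) nth_mem by blast
  note sorted = sorted_wrt_concat_map[OF cop(1)]
  have coprime: "coprime (?p x) (?p y)" if xy: "x \<in> ?I" "y \<in> ?I" "x \<noteq> y" for x y
  proof -
    obtain i k j l where x: "x = (i, k)" and y: "y = (j, l)" by (cases x, cases y)
    have b: "i < length ps" "j < length ps" "k < t" "l < t" using xy x y by auto
    have tw: "dilate (g ^ k) p \<in> set (twists g t p)" "dilate (g ^ l) p \<in> set (twists g t p)" for p
      using b by (auto simp: twists_eq)
    consider "i < j" | "j < i" | "i = j" "k < l" | "i = j" "l < k" using xy(3) x y by fastforce
    then show ?thesis
    proof cases
      case 1 then show ?thesis using sorted b tw x y by (auto simp: sorted_wrt_iff_nth_less)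
    next
      case 2
      then have "coprime (?p y) (?p x)" using sorted b tw x y by (auto simp: sorted_wrt_iff_nth_less)
      then show ?thesis by (simp add: coprime_commute)
    next
      case 3
      have "sorted_wrt coprime (twists g t (ps ! i))" using sorted b by simp
      then show ?thesis using 3 b x y by (auto simp: sorted_wrt_iff_nth_less twists_eq)
    next
      case 4
      have "sorted_wrt coprime (twists g t (ps ! i))" using sorted b by simp
      then have "coprime (?p y) (?p x)" using 4 b x y by (auto simp: sorted_wrt_iff_nth_less twists_eq)
      then show ?thesis by (simp add: coprime_commute)
    qed
  qed
  have prime: "prime_elem (?p x) \<and> degree (?p x) = r" if "x \<in> ?I" for x
  proof -
    obtain i k where x: "x = (i, k)" by (cases x)
    then have "ps ! i \<in> monic_irreducibles r" using that psi by auto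
    then show ?thesis unfolding x using monic_irreducibles_degree(1)
      by (auto simp: degree_dilate nonzero monic_irreducibles_def
          intro!: field_poly_irreducible_imp_prime irreducible_dilate)
  qed
  have "r * (\<Sum>x\<in>?I. ?d (fst x)) \<le> degree \<Omega>"
  proof (rule sum_prime_powers_degree_le[of _ ?p])
    fix x assume x: "x \<in> ?I"
    show "prime_elem (?p x) \<and> degree (?p x) = r" by (rule prime[OF x])
    obtain i k where ik: "x = (i, k)" by (cases x)
    then have i: "i < length ps" and k: "s - 1 \<le> k" "k < t" using x by auto
    have "dilate (g ^ k) (ps ! i) ^ ?d i dvd \<Omega>"
    proof (rule dvd)
      show "vec.subspace (folded_subspace cs g t (ps ! i))"
        using folded_subspace_eq_multiples[of t "ps ! i" r cs] sorted i psi[OF i]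
          subspace_multiples[unfolded multiples_def] by force
      fix v j assume v: "v \<in> folded_subspace cs g t (ps ! i)" and j: "j < s"
      have "k - j \<in> set [0..<t]" using k by auto
      then have "dilate (g ^ (k - j)) (ps ! i) dvd vec_poly cs v"
        using v by (auto simp: folded_subspace_def twists_eq)
      then have "dilate (g ^ j) (dilate (g ^ (k - j)) (ps ! i)) dvd dilate (g ^ j) (vec_poly cs v)"
        by (rule dilate_dvd)
      \<comment> \<open>The truncated subtraction is exact because
        \<open>j \<le> s - 1 \<le> k\<close>.\<close>
      moreover have "j + (k - j) = k" using k j by simp
      ultimately show "dilate (g ^ k) (ps ! i) dvd dilate (g ^ j) (vec_poly cs v)"
        by (simp add: dilate_dilate flip: power_add)
    qed
    then show "?p x ^ ?d (fst x) dvd \<Omega>" by (simp add: ik)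
    fix y assume "y \<in> ?I" "x \<noteq> y"
    then show "\<not> ?p x dvd ?p y" using prime[OF x] coprime[OF x] coprime_primes_not_dvd by blast
  qed (simp_all add: \<Omega>)
  also have "(\<Sum>x\<in>?I. ?d (fst x)) = (t - s + 1) * (\<Sum>i<length ps. ?d i)"
  proof -
    have "(\<Sum>x\<in>?I. ?d (fst x)) = (\<Sum>i<length ps. \<Sum>k\<in>{s - 1..<t}. ?d i)"
      using sum.cartesian_product[of "\<lambda>i k. ?d i" "{s - 1..<t}" "{..<length ps}"]
      by (simp only: case_prod_unfold)
    also have "\<dots> = (\<Sum>i<length ps. (t - s + 1) * ?d i)"
    proof -
      have "card {s - 1..<t} = t - s + 1" using s by simp
      then show ?thesis by (simp only: sum_constant of_nat_id)
    qed
    finally show ?thesis by (simp add: sum_distrib_left)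
  qed
  finally show ?thesis using \<Omega>(2) by (simp only: mult.assoc)
qed

subsection \<open>Size of the collection\<close>

text \<open>From \<open>k \<ge> 1\<close> on, the new term is at most \<open>q ^ (2 * k)\<close>,
  while the right side grows by a factor of at least 4. With \<open>k = r div 2\<close>, a quarter
  of \<open>q ^ r\<close> is left for the irreducibles.\<close>

lemma geometric_sum_le:
  fixes q :: nat assumes "q \<ge> 2"
  shows "4 * (\<Sum>d=1..k. q ^ d) \<le> 3 * q ^ (2 * k)"
proof (induction k)
  case (Suc k)
  show ?case
  proof (cases "k = 0")
    case True
    have "2 * q \<le> q * q" by (rule mult_right_mono[OF assms]) simp
    then have "4 * q \<le> 3 * (q * q)" by linarith
    then show ?thesis using True by (simp add: power2_eq_square)
  next
    case False
    have "q ^ Suc k \<le> q ^ (2 * k)" using False assms by (intro power_increasing) auto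
    moreover have "2 * 2 * q ^ (2 * k) \<le> q * q * q ^ (2 * k)"
      by (intro mult_right_mono mult_mono assms) simp_all
    moreover have "q ^ (2 * Suc k) = q * q * q ^ (2 * k)" by simp
    moreover have "(\<Sum>d=1..Suc k. q ^ d) = (\<Sum>d=1..k. q ^ d) + q ^ Suc k" by simp
    ultimately show ?thesis using Suc by linarith
  qed
qed simp

text \<open>The weight \<open>r + 1\<close> combines \<open>r\<close> copies of the sum for
  irreducibles with dependent twists and one for proper prime powers. Equality holds at
  \<open>q = 4\<close>, \<open>r = 2\<close>, and for \<open>q = 2, 3\<close> the bound fails at
  \<open>r = 2\<close>.\<close>

lemma geometric_sum_le_scaled:
  fixes q :: nat assumes q: "q \<ge> 4" and r: "r \<ge> 2"
  shows "4 * ((r + 1) * (\<Sum>d=1..r div 2. q ^ d)) \<le> 3 * q ^ r"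
proof -
  have S: "3 * (\<Sum>d=1..k. q ^ d) + 4 \<le> 4 * q ^ k" for k
  proof (induction k)
    case (Suc k)
    have "4 * q ^ k \<le> q * q ^ k" by (rule mult_right_mono[OF q]) simp
    moreover have "(\<Sum>d=1..Suc k. q ^ d) = (\<Sum>d=1..k. q ^ d) + q * q ^ k" by simp
    moreover have "q ^ Suc k = q * q ^ k" by simp
    ultimately show ?case using Suc by linarith
  qed simp
  define k where "k = r div 2"
  let ?S = "\<Sum>d=1..k. q ^ d"
  have k: "k \<ge> 1" using r k_def by simp
  have even: "4 * ((2 * k + 1) * ?S) \<le> 3 * q ^ (2 * k)"
  proof (cases "k = 1")
    case True
    have "4 * q \<le> q * q" by (rule mult_right_mono[OF q]) simp
    then have "12 * q \<le> 3 * (q * q)" by linarith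
    then show ?thesis using True by (simp add: power2_eq_square)
  next
    case False
    \<comment> \<open>By \<open>S\<close>, the left side is at most
      \<open>16 / 3 * (2 * k + 1) * q ^ k\<close>, which is below \<open>3 * q ^ (2 * k)\<close>
      exactly when \<open>16 * (2 * k + 1) \<le> 9 * q ^ k\<close>.\<close>
    have "16 * (2 * l + 1) \<le> 9 * (4::nat) ^ l" if "l \<ge> 2" for l using that
      by (induction l rule: dec_induct) auto
    then have "16 * (2 * k + 1) \<le> 9 * (4::nat) ^ k" using False k by simp
    also have "\<dots> \<le> 9 * q ^ k" using q by (intro mult_left_mono power_mono) auto
    finally have "16 * (2 * k + 1) * q ^ k \<le> 9 * q ^ k * q ^ k" by (rule mult_right_mono) simp
    moreover have "3 * ((2 * k + 1) * ?S) \<le> (2 * k + 1) * (4 * q ^ k)"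
      using mult_left_mono[of "3 * ?S" "4 * q ^ k" "2 * k + 1"] S[of k] by (simp add: algebra_simps)
    moreover have "q ^ k * q ^ k = q ^ (2 * k)" by (simp add: mult_2 power_add)
    ultimately show ?thesis by (simp add: algebra_simps)
  qed
  consider "r = 2 * k" | "r = 2 * k + 1" unfolding k_def by linarith
  then have "4 * ((r + 1) * ?S) \<le> 3 * q ^ r"
  proof cases
    case 1 then show ?thesis using even by simp
  next
    case 2
    \<comment> \<open>For odd \<open>r\<close> the weight at most doubles compared with
      \<open>2 * k\<close>, and the additional factor \<open>q\<close> on the right absorbs
      this.\<close>
    have "4 * ((r + 1) * ?S) \<le> 2 * (4 * ((2 * k + 1) * ?S))" using 2 by (simp add: algebra_simps)
    also have "\<dots> \<le> 2 * (3 * q ^ (2 * k))" using even by simp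
    also have "\<dots> \<le> 3 * (q * q ^ (2 * k))" proof -
      have "2 * q ^ (2 * k) \<le> q * q ^ (2 * k)" using q by (intro mult_right_mono) auto
      then show ?thesis by linarith
    qed
    finally show ?thesis using 2 by simp
  qed
  then show ?thesis by (simp add: k_def)
qed

lemma card_le_imp_omega_bound:
  assumes "q ^ r \<le> 100 * (r * t * l)" "0 < r" "0 < t"
  shows "omega_const * (real q ^ r / (real r * real t)) \<le> real l"
proof -
  have "real (q ^ r) \<le> real (100 * (r * t * l))" using assms(1) by (simp only: of_nat_le_iff)
  then show ?thesis using assms(2,3) by (simp add: omega_const_def field_simps)
qed

lemma real_le_divide_design:
  assumes "r * (t - s + 1) * n \<le> B" "0 < r" "s \<le> t"
  shows "real n \<le> real B / (real r * (real t - real s + 1))"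
proof -
  have pos: "0 < real r * (real t - real s + 1)" using assms(2,3) by simp
  have "real (r * (t - s + 1) * n) \<le> real B" using assms(1) by (simp only: of_nat_le_iff)
  moreover have "real (t - s + 1) = real t - real s + 1" using assms(3) by simp
  ultimately have "real n * (real r * (real t - real s + 1)) \<le> real B"
    by (simp only: of_nat_mult mult_ac)
  then show ?thesis using pos by (simp add: pos_le_divide_eq)
qed

lemma length_irreducible_polys_ge:
  assumes "distinct fs" "set fs = (UNIV :: 'a::{finite,field} set)" "0 < r" "0 < t"
  shows "CARD('a) ^ r \<le> 100 * (r * t * length (irreducible_polys fs r))"
proof -
  let ?q = "CARD('a)" and ?N = "card (monic_irreducibles r :: 'a poly set)"
  have "card {0, 1 :: 'a} \<le> ?q" by (rule card_mono) auto
  then have q: "?q \<ge> 2" by simp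
  have "?q ^ (2 * (r div 2)) \<le> ?q ^ r" using q by (intro power_increasing) auto
  then have "4 * (\<Sum>d=1..r div 2. ?q ^ d) \<le> 3 * ?q ^ r"
    using geometric_sum_le[OF q, of "r div 2"] by linarith
  then have "?q ^ r \<le> 4 * (r * ?N)"
    using card_monic_irreducibles_lower[OF assms(3), where 'a='a] by linarith
  moreover have "r * ?N \<le> r * t * ?N" using assms(4) by simp
  ultimately have "?q ^ r \<le> 100 * (r * t * ?N)" by linarith
  then show ?thesis by (simp only: length_irreducible_polys[OF assms(1,2)])
qed

lemma (in primitive) length_select_ge:
  assumes fs: "distinct fs" "set fs = UNIV" and r: "0 < r" and t: "0 < t" "t < CARD('a)" and q: "4 \<le> CARD('a)"
  shows "CARD('a) ^ r \<le> 100 * (r * t * length (select_twist_coprime g t (irreducible_polys fs r)))"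
proof -
  let ?q = "CARD('a)" and ?N = "card (monic_irreducibles r :: 'a poly set)"
  let ?S = "\<Sum>d=1..r div 2. ?q ^ d"
  define L where "L = length (select_twist_coprime g t (irreducible_polys fs r))"
  have N: "?q ^ r \<le> r * ?N + ?S" using card_monic_irreducibles_lower[OF r, where 'a='a] .
  have sel: "?N \<le> L * (2 * t) + (if r = 1 then 1 else 0) + ?S"
    unfolding L_def by (rule card_monic_irreducibles_le_select[OF fs t r])
  have "?q ^ r \<le> 100 * (r * t * L)"
  proof (cases "r = 1")
    case True
    \<comment> \<open>Both geometric sums are empty here, and the summand 1 accounts for the
      polynomial \<open>X\<close>, which all its twists are multiples of.\<close>
    then have "?q \<le> 2 * (t * L) + 1" using N sel by (simp add: mult_ac)
    then show ?thesis using True q by simp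
  next
    case False
    have "r * ?N \<le> r * (L * (2 * t) + ?S)" using sel False by (intro mult_left_mono) simp_all
    also have "\<dots> = 2 * (r * t * L) + r * ?S" by (simp add: algebra_simps)
    finally have "?q ^ r \<le> 2 * (r * t * L) + (r + 1) * ?S" using N by simp
    moreover have "4 * ((r + 1) * ?S) \<le> 3 * ?q ^ r"
      using False r by (intro geometric_sum_le_scaled q) simp
    \<comment> \<open>At most three quarters of \<open>q ^ r\<close> is lost, so
      \<open>q ^ r \<le> 8 * (r * t * L)\<close>.\<close>
    ultimately show ?thesis by linarith
  qed
  then show ?thesis by (simp only: L_def)
qed

text \<open>The codimension is stated as \<open>min (r * t) m\<close> because no subspace has
  codimension above \<open>m\<close>; it is \<open>r * t\<close> whenever
  \<open>r * t \<le> m\<close>. The orders of \<open>fs\<close> and \<open>cs\<close> are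
  arbitrary.\<close>

theorem mainTheorem15:
  fixes s r t m q :: nat
    and fs :: "'a::{finite,field} list" and cs :: "'m::finite list"
  assumes q: "q = CARD('a)" and m: "m = CARD('m)"
    and fs: "distinct fs" "set fs = UNIV"
    and cs: "distinct cs" "set cs = UNIV"
    and pos: "0 < s" "0 < r" "0 < t" "0 < m"
    and le: "s \<le> t" "t \<le> m" "m < q"
  shows "\<exists>(Hs :: ('a ^ 'm) set list) (A :: real).
           Hs = explicit_collection fs cs r t \<and>
           real (length Hs) \<ge> omega_const * (real q ^ r / (real r * real t)) \<and>
           (\<forall>H\<in>set Hs. vec.subspace H \<and> codim H = min (r * t) m) \<and>
           strong_subspace_design s A Hs \<and>
           A \<le> (real m - 1 - (real s - 1) / 2) * real s / (real r * (real t - real s + 1)) \<and>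
           (m < CHAR('a) \<longrightarrow>
             A \<le> (real m - real s) * real s / (real r * (real t - real s + 1)))"
proof -
  interpret coordinates cs by unfold_locales (rule cs)+
  let ?ps = "irreducible_polys fs r"
  have ps: "distinct ?ps" "set ?ps = monic_irreducibles r" using irreducible_polys_props[OF fs] by blast+
  have den: "0 < real r * (real t - real s + 1)" using pos le by simp
  have sum_real: "real (\<Sum>i<s. CARD('m) - 1 - i) = (real m - 1 - (real s - 1) / 2) * real s"
    using sum_descending_real[of s m] le by (simp add: m)
  show ?thesis
  proof (cases "CARD('m) < CHAR('a)")
    case True
    let ?Hs = "map (mult_subspace cs t) ?ps :: ('a ^ 'm) set list"
    let ?A = "(real m - real s) * real s / (real r * (real t - real s + 1))"
    have props: "vec.subspace H \<and> codim H = min (r * t) m" if mem: "H \<in> set ?Hs" for H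
    proof -
      obtain p where p: "p \<in> monic_irreducibles r" and "H = mult_subspace cs t p"
        using mem by (auto simp: ps)
      then have H: "H = multiples (p ^ t)" by (simp add: mult_subspace_def multiples_def)
      have "p ^ t \<noteq> 0" "degree (p ^ t) = r * t"
        using monic_irreducibles_degree[OF p] by (simp_all add: degree_power_eq)
      then show ?thesis using codim_multiples[of "p ^ t"] subspace_multiples by (simp add: H m)
    qed
    have "real (\<Sum>i<length ?Hs. vec.dim (?Hs ! i \<inter> W)) \<le> ?A"
      if W: "vec.subspace W" "vec.dim W = s" for W :: "('a ^ 'm) set"
    proof -
      let ?n = "\<Sum>i<length ?ps. vec.dim (mult_subspace cs t (?ps ! i) \<inter> W)"
      have bound: "r * (t - s + 1) * ?n + (\<Sum>j<s. j) \<le> (\<Sum>i<s. CARD('m) - 1 - i)"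
        by (rule mult_design_bound[OF cs True ps(1) _ W le(1)]) (simp add: ps)
      then have "real ?n \<le> real ((\<Sum>i<s. CARD('m) - 1 - i) - (\<Sum>j<s. j)) / (real r * (real t - real s + 1))"
        by (intro real_le_divide_design pos le) simp
      also have "real ((\<Sum>i<s. CARD('m) - 1 - i) - (\<Sum>j<s. j)) = (real m - real s) * real s"
      proof -
        \<comment> \<open>This makes the subtraction of natural numbers exact, so that it can be
          carried out in the reals.\<close>
        have "(\<Sum>j<s. j) \<le> (\<Sum>i<s. CARD('m) - 1 - i)" using bound by linarith
        moreover have "real (\<Sum>j<s. j) = real s * (real s - 1) / 2"
          unfolding of_nat_sum by (rule sum_lessThan_real)
        ultimately have "real ((\<Sum>i<s. CARD('m) - 1 - i) - (\<Sum>j<s. j))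
            = (real m - 1 - (real s - 1) / 2) * real s - real s * (real s - 1) / 2"
          by (simp only: of_nat_diff sum_real)
        then show ?thesis by (simp add: field_simps)
      qed
      finally show ?thesis by simp
    qed
    then have "strong_subspace_design s ?A ?Hs" using props by (simp add: strong_subspace_design_def)
    moreover have "?A \<le> (real m - 1 - (real s - 1) / 2) * real s / (real r * (real t - real s + 1))"
    proof -
      have "real s \<ge> 1" using pos(1) by simp
      \<comment> \<open>The sharper value of \<open>A\<close> also has to meet the general bound;
        the two numerators differ by \<open>s * (s - 1) / 2\<close>.\<close>
      then have "real m - real s \<le> real m - 1 - (real s - 1) / 2" by (simp add: field_simps)
      then show ?thesis using den by (intro divide_right_mono mult_right_mono) simp_all
    qed
    moreover have "omega_const * (real q ^ r / (real r * real t)) \<le> real (length ?Hs)"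
      unfolding q length_map by (intro card_le_imp_omega_bound length_irreducible_polys_ge fs pos)
    ultimately show ?thesis using True props
      by (intro exI[of _ ?Hs] exI[of _ ?A]) (simp add: explicit_collection_def)
  next
    case False
    define g where "g = primitive_elem fs"
    interpret primitive g unfolding g_def by unfold_locales (rule primitive_elem[OF fs(2)])
    let ?sel = "select_twist_coprime g t ?ps"
    let ?Hs = "map (folded_subspace cs g t) ?sel :: ('a ^ 'm) set list"
    let ?A = "(real m - 1 - (real s - 1) / 2) * real s / (real r * (real t - real s + 1))"
    have sel: "sorted_wrt coprime (concat (map (twists g t) ?sel))" "set ?sel \<subseteq> monic_irreducibles r"
      using select_twist_coprime_props(1,2)[of g t ?ps] ps by auto
    \<comment> \<open>In this case the characteristic is at most \<open>m < q\<close>, so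
      \<open>q\<close> is a proper multiple of it and at least \<open>2 * 2\<close>.\<close>
    have q4: "4 \<le> CARD('a)"
    proof -
      have p2: "2 \<le> CHAR('a)"
        by (intro prime_ge_2_nat prime_CHAR_semidom finite_imp_CHAR_pos) simp
      obtain k where k: "CARD('a) = CHAR('a) * k" using CHAR_dvd_CARD[where 'a='a] by (auto elim: dvdE)
      have "CHAR('a) * 1 < CHAR('a) * k" using False le q m k by linarith
      then have "2 \<le> k" unfolding mult_less_cancel1 by simp
      then have "2 * 2 \<le> CHAR('a) * k" by (rule mult_le_mono[OF p2])
      then show ?thesis using k by simp
    qed
    have props: "vec.subspace H \<and> codim H = min (r * t) m" if mem: "H \<in> set ?Hs" for H
    proof -
      obtain p where p: "p \<in> set ?sel" and H: "H = folded_subspace cs g t p" using mem by auto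
      have "sorted_wrt coprime (twists g t p)" "p \<in> monic_irreducibles r"
        using sorted_wrt_concat_map[OF sel(1)] sel(2) p by blast+
      then obtain D where "D \<noteq> 0" "degree D = r * t" "H = multiples D"
        using folded_subspace_eq_multiples[of t p r cs] unfolding H multiples_def by blast
      then show ?thesis using codim_multiples[of D] subspace_multiples by (simp add: m)
    qed
    have "real (\<Sum>i<length ?Hs. vec.dim (?Hs ! i \<inter> W)) \<le> ?A"
      if W: "vec.subspace W" "vec.dim W = s" for W :: "('a ^ 'm) set"
    proof -
      let ?n = "\<Sum>i<length ?sel. vec.dim (folded_subspace cs g t (?sel ! i) \<inter> W)"
      have "r * (t - s + 1) * ?n \<le> (\<Sum>i<s. CARD('m) - 1 - i)"
        by (rule folded_design_bound[OF cs _ sel W pos(1) le(1)]) (use le q m in simp)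
      then have "real ?n \<le> real (\<Sum>i<s. CARD('m) - 1 - i) / (real r * (real t - real s + 1))"
        by (intro real_le_divide_design pos le)
      then show ?thesis by (simp only: sum_real) simp
    qed
    then have "strong_subspace_design s ?A ?Hs" using props by (simp add: strong_subspace_design_def)
    moreover have "omega_const * (real q ^ r / (real r * real t)) \<le> real (length ?Hs)"
      unfolding q length_map
      by (intro card_le_imp_omega_bound length_select_ge fs pos q4) (use le q in simp)
    ultimately show ?thesis using False props m
      by (intro exI[of _ ?Hs] exI[of _ ?A]) (simp add: explicit_collection_def g_def Let_def)
  qed
qed

end
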